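(* Let $f\in\mathcal{A}_C(\mathbb{R}^+)$ with Laplace transform $\widehat f(z)=\int_0^\infty f(t)e^{-zt}\,dt$, and let $0\le\alpha<\pi/2$. Then $\widehat f(z)=o(1)$ as $z\to\infty$ in the cone $|\arg(z)|\le\alpha$. This estimate is sharp, not only in $\mathcal{A}_C(\mathbb{R}^+)$ but in $L^1$ as well: for each function $A:(0,\infty)\to(0,1)$ with $\lim_{x\to\infty}A(x)=0$ there is $f\in L^1(\mathbb{R}^+)$ such that $\widehat f(x)\ge A(x)$ for all real $x\ge2$.
   Context: $\mathbb{R}^+=(0,\infty)$. $\mathcal{A}_C(\mathbb{R}^+)$ is the set of distributions $f\in\mathcal{D}'(\mathbb{R}^+)$ (dual of $C_c^\infty((0,\infty))$, real-valued) such that $f=F'$ (distributional derivative) for some real function $F$ continuous on $[0,\infty]$ (i.e. continuous on $[0,\infty)$ with $F(\infty)=\lim_{x\to\infty}F(x)$ existing in $\mathbb{R}$) with $F(0)=0$; such $F$ is unique and is called the primitive of $f$. If $g:[0,\infty]\to\mathbb{R}$ is of bounded variation, then $\int_0^\infty fg=\int_0^\infty f(t)g(t)\,dt:=F(\infty)g(\infty)-\int_0^\infty F\,dg$ (Riemann–Stieltjes integral over $[0,\infty]$), extended to complex-valued $g$ by linearity. For $\mathrm{Re}\,z>0$ the function $t\mapsto e^{-zt}$, extended by $0$ at $t=\infty$, is of bounded variation on $[0,\infty]$, so $\widehat f(z)$ is defined; for $f\in L^1(\mathbb{R}^+)\subset\mathcal{A}_C(\mathbb{R}^+)$ it is the usual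 Lebesgue integral. *)

theory Defs
  imports
    "HOL-Analysis.Analysis"
    "HOL-Library.Landau_Symbols"
begin

text \<open>
  Test functions on \<open>(0,\<infinity>)\<close> are identified with their extensions by zero to the real line.
\<close>

definition support :: "(real \<Rightarrow> real) \<Rightarrow> real set" where
  "support \<phi> = closure {x. \<phi> x \<noteq> 0}"

definition test_functions :: "(real \<Rightarrow> real) set" where
  "test_functions =
    {\<phi>. (\<forall>k x. (deriv ^^ k) \<phi> field_differentiable at x) \<and>
        compact (support \<phi>) \<and> support \<phi> \<subseteq> {0<..}}"

definition test_tendsto :: "(nat \<Rightarrow> real \<Rightarrow> real) \<Rightarrow> (real \<Rightarrow> real) \<Rightarrow> bool" where
  "test_tendsto \<phi> \<psi> \<longleftrightarrow>
    (\<exists>K. compact K \<and> K \<subseteq> {0<..} \<and> (\<forall>n. support (\<phi> n) \<subseteq> K)) \<and>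
    (\<forall>k. uniform_limit UNIV (\<lambda>n. (deriv ^^ k) (\<phi> n)) ((deriv ^^ k) \<psi>) sequentially)"

text \<open>
  Distributions are extensional functionals, so that equality of distributions is
  equality in HOL. For linear functionals on test functions, sequential continuity
  coincides with continuity in the usual inductive limit topology.
\<close>

definition distributions :: "((real \<Rightarrow> real) \<Rightarrow> real) set" where
  "distributions =
    {f \<in> extensional test_functions.
      (\<forall>\<phi>\<in>test_functions. \<forall>\<psi>\<in>test_functions. \<forall>a b.
        f (\<lambda>x. a * \<phi> x + b * \<psi> x) = a * f \<phi> + b * f \<psi>) \<and>
      (\<forall>\<phi> \<psi>. range \<phi> \<subseteq> test_functions \<and> \<psi> \<in> test_functions \<and> test_tendsto \<phi> \<psi> \<longrightarrow>
        (\<lambda>n. f (\<phi> n)) \<longlonglongrightarrow> f \<psi>)}"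

definition regular_dist :: "(real \<Rightarrow> real) \<Rightarrow> (real \<Rightarrow> real) \<Rightarrow> real" where
  "regular_dist h = (\<lambda>\<phi>\<in>test_functions. set_lebesgue_integral lebesgue {0<..} (\<lambda>t. h t * \<phi> t))"

definition dist_deriv :: "((real \<Rightarrow> real) \<Rightarrow> real) \<Rightarrow> (real \<Rightarrow> real) \<Rightarrow> real" where
  "dist_deriv f = (\<lambda>\<phi>\<in>test_functions. - f (deriv \<phi>))"

text \<open>
  Functions on \<open>[0,\<infinity>]\<close> live on \<^typ>\<open>ereal\<close>, where continuity at \<open>\<infinity>\<close> says that
  the limit at \<open>\<infinity>\<close> exists and is the value there. Extensionality makes the primitive
  unique as a HOL function.
\<close>

definition primitives :: "(ereal \<Rightarrow> real) set" where
  "primitives = {F \<in> extensional {0..\<infinity>}. continuous_on {0..\<infinity>} F \<and> F 0 = 0}"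

definition is_primitive :: "((real \<Rightarrow> real) \<Rightarrow> real) \<Rightarrow> (ereal \<Rightarrow> real) \<Rightarrow> bool" where
  "is_primitive f F \<longleftrightarrow> F \<in> primitives \<and> f = dist_deriv (regular_dist (\<lambda>t. F (ereal t)))"

definition A_C :: "((real \<Rightarrow> real) \<Rightarrow> real) set" where
  "A_C = {f \<in> distributions. \<exists>F. is_primitive f F}"

definition primitive :: "((real \<Rightarrow> real) \<Rightarrow> real) \<Rightarrow> ereal \<Rightarrow> real" where
  "primitive f = (THE F. is_primitive f F)"

text \<open>
  The Riemann-Stieltjes integral as a limit along refinement of partitions
  (\<open>[0,\<infinity>]\<close> carries no canonical mesh): \<open>P\<close> is the set of points that an admissible
  partition \<open>x 0 < \<dots> < x n\<close> has to contain, and \<open>c i\<close> are the tags.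
\<close>

definition has_RS_integral ::
    "('a::linorder \<Rightarrow> real) \<Rightarrow> ('a \<Rightarrow> real) \<Rightarrow> 'a \<Rightarrow> 'a \<Rightarrow> real \<Rightarrow> bool" where
  "has_RS_integral F g a b I \<longleftrightarrow>
    (\<forall>\<epsilon>>0. \<exists>P. finite P \<and> P \<subseteq> {a..b} \<and>
      (\<forall>n x c. x 0 = a \<and> x n = b \<and>
          (\<forall>i<n. x i < x (Suc i) \<and> c i \<in> {x i..x (Suc i)}) \<and> P \<subseteq> x ` {..n} \<longrightarrow>
        \<bar>(\<Sum>i<n. F (c i) * (g (x (Suc i)) - g (x i))) - I\<bar> < \<epsilon>))"

definition RS_integral :: "('a::linorder \<Rightarrow> real) \<Rightarrow> ('a \<Rightarrow> real) \<Rightarrow> 'a \<Rightarrow> 'a \<Rightarrow> real" where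
  "RS_integral F g a b = (THE I. has_RS_integral F g a b I)"

text \<open>
  The integral of \<open>f g\<close> over \<open>[0,\<infinity>]\<close>, meaningful for \<open>f\<close> in \<^const>\<open>A_C\<close> and
  \<open>g\<close> of bounded variation on \<open>[0,\<infinity>]\<close>.
\<close>

definition AC_integral :: "((real \<Rightarrow> real) \<Rightarrow> real) \<Rightarrow> (ereal \<Rightarrow> real) \<Rightarrow> real" where
  "AC_integral f g = primitive f \<infinity> * g \<infinity> - RS_integral (primitive f) g 0 \<infinity>"

definition AC_integral_complex :: "((real \<Rightarrow> real) \<Rightarrow> real) \<Rightarrow> (ereal \<Rightarrow> complex) \<Rightarrow> complex" where
  "AC_integral_complex f g =
    Complex (AC_integral f (\<lambda>t. Re (g t))) (AC_integral f (\<lambda>t. Im (g t)))"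

definition laplace_kernel :: "complex \<Rightarrow> ereal \<Rightarrow> complex" where
  "laplace_kernel z t = (if t = \<infinity> then 0 else exp (- z * of_real (real_of_ereal t)))"

definition laplace :: "((real \<Rightarrow> real) \<Rightarrow> real) \<Rightarrow> complex \<Rightarrow> complex" where
  "laplace f z = AC_integral_complex f (laplace_kernel z)"

end

theory Submission
  imports Defs
begin

text \<open>
  Integrating against \<open>g' dt\<close> turns the Stieltjes integral into \<open>z \<integral> F(t) e\<^sup>-\<^sup>z\<^sup>t dt\<close>, where \<open>F\<close>
  is the primitive of \<open>f\<close>. As \<open>F\<close> is bounded and tends to \<open>0\<close> at \<open>0\<close>, for every \<open>c > 0\<close> there is
  \<open>C\<close> with \<open>\<bar>F(t)\<bar> \<le> c + C t\<close>, so the integral is at most \<open>(\<bar>z\<bar> / Re z) (c + C / Re z)\<close>, and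
  \<open>\<bar>z\<bar> / Re z \<le> 1 / cos \<alpha>\<close> in the cone.

  For sharpness, a nondecreasing nonnegative primitive satisfies
  \<open>x \<integral> F(t) e\<^sup>-\<^sup>x\<^sup>t dt \<ge> F(1/x) / e\<close>, so it is enough to find such an \<open>F\<close>, of class \<open>C\<^sup>1\<close> on
  \<open>(0, \<infinity>)\<close> and vanishing at \<open>0\<close>, with \<open>F(1/x) \<ge> e A(x)\<close>. Take the monotone envelope
  \<open>sup {A(1/s) | s \<le> t}\<close> and replace it twice by its mean over \<open>[t, 2t]\<close>, which does not decrease it.
  The integrability of \<open>F'\<close> follows from \<open>F' \<ge> 0\<close> and the boundedness of \<open>F\<close>.
\<close>

section \<open>Riemann-Stieltjes integrals on the extended half line\<close>

text \<open>Compactness of \<open>[0,\<infinity>]\<close> in two pieces: beyond \<open>T\<close>,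
  continuity at \<open>\<infinity>\<close> keeps \<open>F\<close> within \<open>\<epsilon>/2\<close>
  of \<open>F \<infinity>\<close>; on \<open>[0,T]\<close>, uniform continuity allows an equidistant
  grid. The conclusion speaks of any interval without points of \<open>P\<close> in its interior, so
  that it passes to every refinement of \<open>P\<close>.\<close>

lemma small_oscillation_partition:
  fixes F :: "ereal \<Rightarrow> real"
  assumes cont: "continuous_on {0..\<infinity>} F" and "0 < \<epsilon>"
  obtains P where "finite P" "P \<subseteq> {0..\<infinity>}"
    "\<And>x y s t. \<lbrakk>0 \<le> x; P \<inter> {x<..<y} = {}; s \<in> {x..y}; t \<in> {x..y}\<rbrakk> \<Longrightarrow> \<bar>F s - F t\<bar> < \<epsilon>"
proof -
  obtain U where U: "open U" "\<infinity> \<in> U" "\<And>t. 0 \<le> t \<Longrightarrow> t \<in> U \<Longrightarrow> F t \<in> ball (F \<infinity>) (\<epsilon>/2)"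
  proof -
    have "F \<infinity> \<in> ball (F \<infinity>) (\<epsilon>/2)" using \<open>0 < \<epsilon>\<close> by simp
    with cont[unfolded continuous_on_topological, rule_format, of \<infinity> "ball (F \<infinity>) (\<epsilon>/2)"]
    show thesis using that by auto
  qed
  obtain T0 where T0: "{ereal T0<..} \<subseteq> U" using U(1,2) open_PInfty by blast
  define T where "T = max 1 (T0 + 1)"
  have T: "T \<ge> 1" "T > T0" by (auto simp: T_def)
  have far: "\<bar>F t - F \<infinity>\<bar> < \<epsilon>/2" if "t \<ge> ereal T" for t
  proof -
    have "ereal T0 < ereal T" "(0::ereal) \<le> ereal T" using T by auto
    with that have "t > ereal T0" "0 \<le> t" by (meson order_less_le_trans order_trans)+
    then have "F t \<in> ball (F \<infinity>) (\<epsilon>/2)" using U(3) T0 by auto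
    then show ?thesis by (simp add: dist_real_def abs_minus_commute)
  qed
  have "continuous_on {0..T} (\<lambda>t. F (ereal t))"
    by (rule continuous_on_compose2[OF cont]) (auto intro!: continuous_intros)
  then have "uniformly_continuous_on {0..T} (\<lambda>t. F (ereal t))"
    by (intro compact_uniformly_continuous) auto
  then obtain \<delta> where \<delta>: "\<delta> > 0"
    "\<And>s t. s \<in> {0..T} \<Longrightarrow> t \<in> {0..T} \<Longrightarrow> \<bar>s - t\<bar> < \<delta> \<Longrightarrow> \<bar>F (ereal s) - F (ereal t)\<bar> < \<epsilon>"
    unfolding uniformly_continuous_on_def dist_real_def using \<open>0 < \<epsilon>\<close> by metis
  obtain N :: nat where N: "real N > T / \<delta>" using reals_Archimedean2 by blast
  have Npos: "real N > 0" using N T(1) \<delta>(1) by (smt (verit) divide_pos_pos)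
  have step: "T / N < \<delta>" using N Npos \<delta>(1) by (simp add: field_simps)
  \<comment> \<open>\<open>k = N\<close> puts \<open>T\<close> itself into \<open>P\<close>, so an
    interval that avoids \<open>P\<close> in its interior cannot start before \<open>T\<close> and
    end after it.\<close>
  define P where "P = (\<lambda>k. ereal (real k * T / N)) ` {..N}"
  show thesis
  proof (rule that)
    show "finite P" by (simp add: P_def)
    show "P \<subseteq> {0..\<infinity>}" using T Npos by (auto simp: P_def)
    fix x y s t :: ereal
    assume x: "0 \<le> x" and disj: "P \<inter> {x<..<y} = {}" and s: "s \<in> {x..y}" and t: "t \<in> {x..y}"
    show "\<bar>F s - F t\<bar> < \<epsilon>"
    proof (cases "x \<ge> ereal T")
      case True
      then have "s \<ge> ereal T" "t \<ge> ereal T" using s t by (auto intro: order_trans)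
      then show ?thesis using far[of s] far[of t] by linarith
    next
      case False
      then obtain x' where x': "x = ereal x'" "0 \<le> x'" "x' < T" using x by (cases x) auto
      \<comment> \<open>Index of the last grid point at or before \<open>x'\<close>. The next grid
        point lies strictly beyond \<open>x'\<close>, hence not before \<open>y\<close>.\<close>
      define k where "k = nat \<lfloor>x' * N / T\<rfloor>"
      have k: "real k \<le> x' * N / T" "x' * N / T < real k + 1"
        using x' T(1) by (auto simp: k_def)
      have "x' * N / T < N" using x' T Npos by (simp add: field_simps)
      then have kN: "Suc k \<le> N" using k by linarith
      have "x' < real (Suc k) * T / N" using k(2) Npos T(1) by (simp add: field_simps)
      moreover have "ereal (real (Suc k) * T / N) \<in> P" using kN unfolding P_def by blast
      ultimately have y: "y \<le> ereal (real (Suc k) * T / N)" using disj x' by force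
      have len: "real (Suc k) * T / N \<le> x' + T / N"
        using k(1) Npos T(1) by (simp add: field_simps)
      have "real (Suc k) * T \<le> real N * T" using kN T(1) by (intro mult_right_mono) linarith+
      then have top: "real (Suc k) * T / N \<le> T" using Npos by (simp add: field_simps)
      obtain s' where s': "s = ereal s'" using s y x' by (cases s) auto
      obtain t' where t': "t = ereal t'" using t y x' by (cases t) auto
      have "x' \<le> s'" "x' \<le> t'" using s t x' s' t' by auto
      moreover have "s \<le> ereal (real (Suc k) * T / N)" "t \<le> ereal (real (Suc k) * T / N)"
        using order_trans[of s, OF _ y] order_trans[of t, OF _ y] s t by simp_all
      ultimately have "s' \<in> {0..T}" "t' \<in> {0..T}" "\<bar>s' - t'\<bar> < \<delta>"
        using x'(2) len step top unfolding s' t' ereal_less_eq atLeastAtMost_iff abs_less_iff by linarith+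
      then show ?thesis using \<delta>(2) s' t' by blast
    qed
  qed
qed

section \<open>Common refinements and uniqueness of the Stieltjes integral\<close>

text \<open>Sorting \<open>P\<close> together with both end points gives the partition. Thus the
  condition in \<open>has_RS_integral\<close> is not vacuous, and uniqueness rests on this.\<close>

lemma partition_of_finite_superset:
  fixes P :: "'a::linorder set"
  assumes "finite P" "P \<subseteq> {a..b}" "a < b"
  obtains n x where "x 0 = a" "x n = b" "\<And>i. i < n \<Longrightarrow> x i < x (Suc i)" "P \<subseteq> x ` {..n::nat}"
proof -
  define Q where "Q = insert a (insert b P)"
  have Q: "finite Q" "P \<subseteq> Q" "a \<in> Q" "b \<in> Q" "Q \<subseteq> {a..b}" using assms by (auto simp: Q_def)
  define xs where "xs = sorted_list_of_set Q"
  have xs: "set xs = Q" "sorted_wrt (<) xs" using Q by (auto simp: xs_def)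
  have ne: "length xs > 0" using xs(1) Q by auto
  obtain i j where ij: "i < length xs" "xs ! i = a" "j < length xs" "xs ! j = b"
    using xs Q by (metis in_set_conv_nth)
  have less: "xs ! k < xs ! l" if "k < l" "l < length xs" for k l
    using xs(2) that sorted_wrt_iff_nth_less by blast
  have range: "xs ! k \<in> {a..b}" if "k < length xs" for k using that xs(1) Q(5) nth_mem by blast
  have "i = 0"
  proof (rule ccontr)
    assume "i \<noteq> 0"
    then have "xs ! 0 < a" using less[of 0 i] ij by auto
    then show False using range[of 0] ne by auto
  qed
  moreover have "j = length xs - 1"
  proof (rule ccontr)
    assume "j \<noteq> length xs - 1"
    then have "b < xs ! (length xs - 1)" using less[of j "length xs - 1"] ij by auto
    then show False using range[of "length xs - 1"] ne by auto
  qed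
  ultimately show thesis
  proof (intro that[of "(!) xs" "length xs - 1"])
    show "P \<subseteq> (!) xs ` {..length xs - 1}"
    proof
      fix p assume "p \<in> P"
      then obtain k where "k < length xs" "xs ! k = p" using xs(1) Q(2) by (metis in_set_conv_nth subsetD)
      then show "p \<in> (!) xs ` {..length xs - 1}" by force
    qed
  qed (use ij less in auto)
qed

text \<open>A partition through both prescribed point sets yields one Riemann sum that is closer
  than half of \<open>\<bar>I - J\<bar>\<close> to both values.\<close>

lemma has_RS_integral_unique:
  assumes I: "has_RS_integral F g a b I" and J: "has_RS_integral F g a b J" and "a < b"
  shows "I = J"
proof (rule ccontr)
  assume "I \<noteq> J"
  define \<epsilon> where "\<epsilon> = \<bar>I - J\<bar> / 2"
  have "\<epsilon> > 0" using \<open>I \<noteq> J\<close> by (simp add: \<epsilon>_def)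
  obtain P where P: "finite P" "P \<subseteq> {a..b}" "\<And>n x c. x 0 = a \<and> x n = b \<and>
          (\<forall>i<n. x i < x (Suc i) \<and> c i \<in> {x i..x (Suc i)}) \<and> P \<subseteq> x ` {..n} \<Longrightarrow>
        \<bar>(\<Sum>i<n. F (c i) * (g (x (Suc i)) - g (x i))) - I\<bar> < \<epsilon>"
    using I \<open>\<epsilon> > 0\<close> unfolding has_RS_integral_def by meson
  obtain Q where Q: "finite Q" "Q \<subseteq> {a..b}" "\<And>n x c. x 0 = a \<and> x n = b \<and>
          (\<forall>i<n. x i < x (Suc i) \<and> c i \<in> {x i..x (Suc i)}) \<and> Q \<subseteq> x ` {..n} \<Longrightarrow>
        \<bar>(\<Sum>i<n. F (c i) * (g (x (Suc i)) - g (x i))) - J\<bar> < \<epsilon>"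
    using J \<open>\<epsilon> > 0\<close> unfolding has_RS_integral_def by meson
  obtain n x where x: "x 0 = a" "x n = b" "\<And>i. i < n \<Longrightarrow> x i < x (Suc i)" "P \<union> Q \<subseteq> x ` {..n::nat}"
    by (rule partition_of_finite_superset[OF finite_UnI[OF P(1) Q(1)] Un_least[OF P(2) Q(2)] \<open>a < b\<close>])
      (rule that)
  have part: "\<forall>i<n. x i < x (Suc i) \<and> x i \<in> {x i..x (Suc i)}" using x(3) by (auto intro: less_imp_le)
  define S where "S = (\<Sum>i<n. F (x i) * (g (x (Suc i)) - g (x i)))"
  have "\<bar>S - I\<bar> < \<epsilon>" unfolding S_def
    by (rule P(3)) (use x part in auto)
  moreover have "\<bar>S - J\<bar> < \<epsilon>" unfolding S_def
    by (rule Q(3)) (use x part in auto)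
  ultimately show False unfolding \<epsilon>_def by argo
qed

lemma partition_monotone:
  fixes x :: "nat \<Rightarrow> 'a::linorder"
  assumes "\<And>i. i < n \<Longrightarrow> x i < x (Suc i)" "i \<le> j" "j \<le> n"
  shows "x i \<le> x j"
  using assms(2,3)
proof (induction j)
  case (Suc j)
  show ?case
  proof (cases "i = Suc j")
    case False
    then have "x i \<le> x j" using Suc by auto
    also have "x j < x (Suc j)" using Suc assms(1) by auto
    finally show ?thesis by simp
  qed simp
qed simp

section \<open>Integrators with an integrable density\<close>

lemma set_integrable_einterval_subset:
  fixes f :: "real \<Rightarrow> real"
  assumes "set_integrable lborel (einterval a b) f" "a \<le> c" "d \<le> b"
  shows "set_integrable lborel (einterval c d) f"
  using assms(1)
  by (rule set_integrable_subset)
    (use assms(2,3) in \<open>auto simp: einterval_def intro: order_le_less_trans order_less_le_trans\<close>)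

lemma interval_integral_partition:
  fixes f :: "real \<Rightarrow> real"
  assumes "set_integrable lborel (einterval (x 0) (x n)) f" "\<And>i. i < n \<Longrightarrow> x i < x (Suc i)"
  shows "(\<Sum>i<n. LBINT t=x i..x (Suc i). f t) = (LBINT t=x 0..x n. f t)"
  using assms
proof (induction n)
  case (Suc n)
  have le: "x 0 \<le> x n" using partition_monotone[of "Suc n" x 0 n] Suc.prems by auto
  have lt: "x n < x (Suc n)" using Suc.prems by auto
  have "(\<Sum>i<n. LBINT t=x i..x (Suc i). f t) = (LBINT t=x 0..x n. f t)"
    using Suc.prems lt by (intro Suc.IH set_integrable_einterval_subset[OF Suc.prems(1)]) (auto intro: less_imp_le)
  moreover have "(LBINT t=x 0..x n. f t) + (LBINT t=x n..x (Suc n). f t) = (LBINT t=x 0..x (Suc n). f t)"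
    by (rule interval_integral_sum)
      (use le less_imp_le[OF lt] order_trans[OF le less_imp_le[OF lt]] Suc.prems
        in \<open>simp add: interval_lebesgue_integrable_def min_absorb1 max_absorb2\<close>)
  ultimately show ?case by simp
qed simp

lemma bounded_on_ereal_half_line:
  fixes F :: "ereal \<Rightarrow> real"
  assumes "continuous_on {0..\<infinity>} F"
  obtains M where "M > 0" "\<And>t. 0 \<le> t \<Longrightarrow> \<bar>F t\<bar> \<le> M"
proof -
  have "bounded (F ` {0..\<infinity>})"
    using compact_imp_bounded[OF compact_continuous_image[OF assms]] by (simp add: compact_eq_closed)
  then show thesis using that unfolding bounded_pos by auto
qed

lemma set_integrable_times_continuous:
  fixes F :: "ereal \<Rightarrow> real" and k :: "real \<Rightarrow> real"
  assumes F: "continuous_on {0..\<infinity>} F" and k: "continuous_on UNIV k"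
    and int: "set_integrable lborel (einterval 0 \<infinity>) k"
  shows "set_integrable lborel (einterval 0 \<infinity>) (\<lambda>t. F (ereal t) * k t)"
proof -
  obtain M where M: "M > 0" "\<And>t. 0 \<le> t \<Longrightarrow> \<bar>F t\<bar> \<le> M" using bounded_on_ereal_half_line[OF F] by blast
  have sub: "continuous_on (einterval 0 \<infinity>) (\<lambda>t. F (ereal t) * k t)"
    by (intro continuous_intros continuous_on_compose2[OF F] continuous_on_subset[OF k])
      (auto simp: einterval_def)
  show ?thesis
  proof (rule set_integrable_bound[of _ _ "\<lambda>t. M * k t"])
    show "set_integrable lborel (einterval 0 \<infinity>) (\<lambda>t. M * k t)" using int by simp
    show "set_borel_measurable lborel (einterval 0 \<infinity>) (\<lambda>t. F (ereal t) * k t)"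
      using borel_measurable_continuous_on_indicator[OF _ sub] by (simp add: set_borel_measurable_def)
    show "AE t in lborel. t \<in> einterval 0 \<infinity> \<longrightarrow> norm (F (ereal t) * k t) \<le> norm (M * k t)"
      using M by (auto simp: einterval_def abs_mult intro!: mult_right_mono)
  qed
qed

text \<open>On each cell the increment of the integrator is the integral of \<open>k\<close>, and
  replacing \<open>F\<close> by its value at the tag costs at most \<open>\<eta>\<close> times the
  integral of \<open>\<bar>k\<bar>\<close> over the cell. The errors add up to at most
  \<open>\<eta> * V\<close>, whatever the number of cells.\<close>

lemma has_RS_integral_density:
  fixes F :: "ereal \<Rightarrow> real" and g k :: "real \<Rightarrow> real"
  assumes F: "continuous_on {0..\<infinity>} F"
    and g: "\<And>t. (g has_real_derivative k t) (at t)" "(g \<longlongrightarrow> 0) at_top"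
    and k: "continuous_on UNIV k" "set_integrable lborel (einterval 0 \<infinity>) k"
  shows "has_RS_integral F (\<lambda>t. if t = \<infinity> then 0 else g (real_of_ereal t)) 0 \<infinity>
    (LBINT t=0..\<infinity>. F (ereal t) * k t)"
  unfolding has_RS_integral_def
proof (intro allI impI)
  define G where "G = (\<lambda>t. if t = \<infinity> then 0 else g (real_of_ereal t))"
  fix \<epsilon> :: real assume "\<epsilon> > 0"
  define V where "V = (LBINT t=0..\<infinity>. \<bar>k t\<bar>)"
  have absk: "set_integrable lborel (einterval 0 \<infinity>) (\<lambda>t. \<bar>k t\<bar>)" using k(2) by (rule set_integrable_abs)
  have "V \<ge> 0" unfolding V_def interval_lebesgue_integral_le_eq[of 0 \<infinity>, simplified] set_lebesgue_integral_def
    by (intro Bochner_Integration.integral_nonneg) auto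
  \<comment> \<open>Dividing by \<open>V + 1\<close> covers \<open>V = 0\<close> and keeps
    \<open>\<eta> * V < \<epsilon>\<close> strict.\<close>
  define \<eta> where "\<eta> = \<epsilon> / (V + 1)"
  have \<eta>: "\<eta> > 0" "\<eta> * V < \<epsilon>" using \<open>\<epsilon> > 0\<close> \<open>V \<ge> 0\<close> by (auto simp: \<eta>_def field_simps)
  obtain P where P: "finite P" "P \<subseteq> {0..\<infinity>}" "\<And>x y s t. \<lbrakk>0 \<le> x; P \<inter> {x<..<y} = {}; s \<in> {x..y}; t \<in> {x..y}\<rbrakk> \<Longrightarrow> \<bar>F s - F t\<bar> < \<eta>"
    using small_oscillation_partition[OF F \<eta>(1)] by blast
  have Fk: "set_integrable lborel (einterval 0 \<infinity>) (\<lambda>t. F (ereal t) * k t)"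
    by (rule set_integrable_times_continuous[OF F k])
  have cell: "\<bar>F c * (G y - G x) - (LBINT t=x..y. F (ereal t) * k t)\<bar> \<le> \<eta> * (LBINT t=x..y. \<bar>k t\<bar>)"
    if "0 \<le> x" "x < y" "P \<inter> {x<..<y} = {}" "c \<in> {x..y}" for x y c
  proof -
    have ix: "set_integrable lborel (einterval x y) h" if "set_integrable lborel (einterval 0 \<infinity>) h" for h :: "real \<Rightarrow> real"
      using that \<open>0 \<le> x\<close> by (rule set_integrable_einterval_subset) simp
    obtain x' where x': "x = ereal x'" using \<open>0 \<le> x\<close> \<open>x < y\<close> by (cases x) auto
    have gc: "isCont g t" for t using g(1) DERIV_isCont by blast
    \<comment> \<open>The fundamental theorem with one-sided limits at the ends also covers
      \<open>y = \<infinity>\<close>, where the limit \<open>0\<close> of \<open>g\<close> is the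
      value of \<open>G\<close>.\<close>
    have "(LBINT t=x..y. k t) = G y - G x"
    proof (rule interval_integral_FTC_integrable[where F = g])
      show "((g \<circ> real_of_ereal) \<longlongrightarrow> G x) (at_right x)"
        using gc[of x'] by (auto simp: x' G_def ereal_tendsto_simps1 isCont_def intro: filterlim_mono at_le)
      show "((g \<circ> real_of_ereal) \<longlongrightarrow> G y) (at_left y)"
      proof (cases y)
        case (real y')
        then show ?thesis using gc[of y'] by (auto simp: G_def ereal_tendsto_simps1 isCont_def intro: filterlim_mono at_le)
      next
        case PInf
        then show ?thesis using g(2) by (simp add: G_def ereal_tendsto_simps1)
      qed (use \<open>x < y\<close> in auto)
    qed (use that g(1) ix k in \<open>auto simp: has_real_derivative_iff_has_vector_derivative continuous_on_eq_continuous_at\<close>)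
    then have "F c * (G y - G x) - (LBINT t=x..y. F (ereal t) * k t) = (LBINT t:einterval x y. F c * k t) - (LBINT t:einterval x y. F (ereal t) * k t)"
      using less_imp_le[OF \<open>x < y\<close>] by (simp add: interval_lebesgue_integral_def)
    also have "\<dots> = (LBINT t:einterval x y. F c * k t - F (ereal t) * k t)"
      by (rule set_integral_diff(2)[symmetric]) (use ix Fk k in auto)
    also have "\<bar>\<dots>\<bar> \<le> (LBINT t:einterval x y. \<bar>F c * k t - F (ereal t) * k t\<bar>)"
      using ix Fk k unfolding set_lebesgue_integral_def
      by (intro order_trans[OF integral_abs_bound]) (auto simp: abs_mult)
    also have "\<dots> \<le> (LBINT t:einterval x y. \<eta> * \<bar>k t\<bar>)"
    proof (rule set_integral_mono)
      fix t assume "t \<in> einterval x y"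
      then have "ereal t \<in> {x..y}" by (auto simp: einterval_def)
      then have "\<bar>F c - F (ereal t)\<bar> \<le> \<eta>" using P(3)[of x y c "ereal t"] that by auto
      then show "\<bar>F c * k t - F (ereal t) * k t\<bar> \<le> \<eta> * \<bar>k t\<bar>"
        by (metis abs_ge_zero abs_mult left_diff_distrib mult_right_mono)
    qed (use ix Fk k absk in \<open>auto intro!: set_integrable_abs set_integral_diff(1)\<close>)
    finally show ?thesis using less_imp_le[OF \<open>x < y\<close>] by (simp add: interval_lebesgue_integral_def)
  qed
  show "\<exists>P. finite P \<and> P \<subseteq> {0..\<infinity>} \<and>
      (\<forall>n x c. x 0 = 0 \<and> x n = \<infinity> \<and>
          (\<forall>i<n. x i < x (Suc i) \<and> c i \<in> {x i..x (Suc i)}) \<and> P \<subseteq> x ` {..n} \<longrightarrow>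
        \<bar>(\<Sum>i<n. F (c i) * ((if x (Suc i) = \<infinity> then 0 else g (real_of_ereal (x (Suc i)))) - (if x i = \<infinity> then 0 else g (real_of_ereal (x i))))) -
         (LBINT t=0..\<infinity>. F (ereal t) * k t)\<bar> < \<epsilon>)"
    unfolding G_def[THEN fun_cong, symmetric]
  proof (intro exI[of _ P] conjI allI impI P(1,2))
    fix n x c
    assume "x 0 = 0 \<and> x n = \<infinity> \<and> (\<forall>i<n. x i < x (Suc i) \<and> c i \<in> {x i..x (Suc i)}) \<and> P \<subseteq> x ` {..n}"
    then have x: "x 0 = 0" "x n = \<infinity>" "\<And>i. i < n \<Longrightarrow> x i < x (Suc i)" "\<And>i. i < n \<Longrightarrow> c i \<in> {x i..x (Suc i)}" "P \<subseteq> x ` {..n}"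
      by auto
    have each: "\<bar>F (c i) * (G (x (Suc i)) - G (x i)) - (LBINT t=x i..x (Suc i). F (ereal t) * k t)\<bar>
        \<le> \<eta> * (LBINT t=x i..x (Suc i). \<bar>k t\<bar>)" if "i < n" for i
    proof (rule cell)
      show "0 \<le> x i" using partition_monotone[of n x 0 i] x that by auto
      show "P \<inter> {x i<..<x (Suc i)} = {}"
      proof -
        \<comment> \<open>Points of \<open>P\<close> are nodes, and by monotonicity no node lies
          strictly between two consecutive ones.\<close>
        have False if j: "j \<le> n" "x i < x j" "x j < x (Suc i)" for j
        proof (cases "j \<le> i")
          case True
          then show False using partition_monotone[of n x j i] x(3) j \<open>i < n\<close> by fastforce
        next
          case False
          then show False using partition_monotone[of n x "Suc i" j] x(3) j \<open>i < n\<close> by fastforce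
        qed
        then show ?thesis using x(5) by fastforce
      qed
    qed (use x that in auto)
    have "\<bar>(\<Sum>i<n. F (c i) * (G (x (Suc i)) - G (x i))) - (LBINT t=0..\<infinity>. F (ereal t) * k t)\<bar>
       = \<bar>\<Sum>i<n. F (c i) * (G (x (Suc i)) - G (x i)) - (LBINT t=x i..x (Suc i). F (ereal t) * k t)\<bar>"
      using interval_integral_partition[of x n] x Fk by (simp add: sum_subtractf)
    also have "\<dots> \<le> (\<Sum>i<n. \<eta> * (LBINT t=x i..x (Suc i). \<bar>k t\<bar>))"
      using each by (intro order_trans[OF sum_abs] sum_mono) auto
    also have "\<dots> = \<eta> * V"
      using interval_integral_partition[of x n] x absk by (simp add: V_def sum_distrib_left[symmetric])
    finally show "\<bar>(\<Sum>i<n. F (c i) * (G (x (Suc i)) - G (x i))) - (LBINT t=0..\<infinity>. F (ereal t) * k t)\<bar> < \<epsilon>"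
      using \<eta>(2) by linarith
  qed
qed

lemma RS_integral_density:
  fixes F :: "ereal \<Rightarrow> real" and g k :: "real \<Rightarrow> real"
  assumes "continuous_on {0..\<infinity>} F"
    and "\<And>t. (g has_real_derivative k t) (at t)" "(g \<longlongrightarrow> 0) at_top"
    and "continuous_on UNIV k" "set_integrable lborel (einterval 0 \<infinity>) k"
  shows "RS_integral F (\<lambda>t. if t = \<infinity> then 0 else g (real_of_ereal t)) 0 \<infinity>
    = (LBINT t=0..\<infinity>. F (ereal t) * k t)"
  unfolding RS_integral_def
  by (intro the_equality has_RS_integral_density[OF assms]
      has_RS_integral_unique[OF _ has_RS_integral_density[OF assms]]) auto

section \<open>Bump functions and the du Bois-Reymond lemma\<close>

text \<open>The polynomial and the exponent are parameters so that the family is closed under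
  differentiation.\<close>

definition flat_bump :: "real \<Rightarrow> nat \<Rightarrow> real poly \<Rightarrow> real \<Rightarrow> real" where
  "flat_bump r m p x =
    (if \<bar>x\<bar> < r then poly p x * exp (- 1 / (r\<^sup>2 - x\<^sup>2)) / (r\<^sup>2 - x\<^sup>2) ^ m else 0)"

text \<open>Keep only the term of order \<open>m + 2\<close> in the series of
  \<open>exp (1/u)\<close>. The two surplus powers of \<open>u\<close> provide the quadratic decay
  at the edge of a bump.\<close>

lemma exp_minus_inverse_le:
  fixes u :: real
  assumes "u > 0"
  shows "exp (- 1 / u) / u ^ m \<le> fact (m + 2) * u\<^sup>2"
proof -
  have "(1/u) ^ (m + 2) / fact (m + 2) \<le> exp (1/u)"
  proof -
    have "(\<Sum>k\<in>{m+2}. (1/u) ^ k / fact k) \<le> (\<Sum>k. (1/u) ^ k / fact k)"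
      using summable_exp[of "1/u"] assms
      by (intro sum_le_suminf) (auto simp: field_simps)
    then show ?thesis by (simp add: exp_def divide_inverse mult.commute scaleR_conv_of_real)
  qed
  then have "1 / (u ^ m * u\<^sup>2) / fact (m + 2) \<le> exp (1/u)"
    by (simp add: power_one_over power_add del: fact_Suc add_2_eq_Suc')
  moreover have "u ^ m * u\<^sup>2 > 0" "u ^ m > 0" "(fact (m + 2) :: real) > 0" using assms by simp_all
  ultimately have "1 \<le> exp (1/u) * fact (m + 2) * (u ^ m * u\<^sup>2)"
    by (simp only: pos_divide_le_eq)
  then show ?thesis using \<open>u ^ m > 0\<close>
    by (simp only: exp_minus divide_minus_left pos_divide_le_eq inverse_eq_divide exp_gt_zero mult_ac)
qed

text \<open>With \<open>u = r^2 - x^2\<close>, differentiation inside gives the numerator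
  \<open>p' * u^2 + (m * u - 1) * p * 2 * x\<close> over \<open>u^(m + 2)\<close>; the polynomials
  \<open>[:r\<^sup>2, 0, -1:]\<close> and \<open>[:0, 2:]\<close> are \<open>u\<close> and
  \<open>2 * x\<close>. Outside and at the edge the derivative is \<open>0\<close>.\<close>

lemma flat_bump_derivative:
  assumes r: "r > 0"
  shows "(flat_bump r m p has_real_derivative
    flat_bump r (m + 2) (pderiv p * [:r\<^sup>2, 0, -1:]\<^sup>2 +
      (smult (real m) [:r\<^sup>2, 0, -1:] - 1) * p * [:0, 2:]) x) (at x)"
proof -
  consider "\<bar>x\<bar> < r" | "\<bar>x\<bar> > r" | "\<bar>x\<bar> = r" by linarith
  then show ?thesis
  proof cases
    case 1
    define u where "u = r\<^sup>2 - x\<^sup>2"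
    have u: "u > 0" using power_strict_mono[OF 1, of 2] by (simp add: u_def)
    have "((\<lambda>x. poly p x * exp (- 1 / (r\<^sup>2 - x\<^sup>2)) / (r\<^sup>2 - x\<^sup>2) ^ m) has_real_derivative
      (poly (pderiv p) x * u\<^sup>2 + (real m * u - 1) * poly p x * (2 * x)) * exp (- 1 / u) / u ^ (m + 2)) (at x)"
    \<comment> \<open>The derivative of \<open>u^m\<close> carries the natural exponent
      \<open>m - 1\<close>, hence the split at \<open>m = 0\<close>.\<close>
    proof (cases m)
      case 0
      show ?thesis unfolding 0 using u
        by (auto simp: u_def[symmetric] intro!: derivative_eq_intros)
          (simp add: field_simps power2_eq_square)
    next
      case (Suc k)
      show ?thesis unfolding Suc using u
        by (auto simp: u_def[symmetric] intro!: derivative_eq_intros)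
          (cases k; simp add: field_simps power2_eq_square)
    qed
    then have "((\<lambda>x. poly p x * exp (- 1 / (r\<^sup>2 - x\<^sup>2)) / (r\<^sup>2 - x\<^sup>2) ^ m) has_real_derivative
      flat_bump r (m + 2) (pderiv p * [:r\<^sup>2, 0, -1:]\<^sup>2 +
      (smult (real m) [:r\<^sup>2, 0, -1:] - 1) * p * [:0, 2:]) x) (at x)"
      by (rule DERIV_cong) (use 1 in \<open>simp add: flat_bump_def u_def power2_eq_square algebra_simps\<close>)
    then show ?thesis
    proof (rule has_field_derivative_transform_within_open)
      show "open {-r<..<r}" by simp
    qed (use 1 in \<open>auto simp: flat_bump_def\<close>)
  next
    case 2
    have "((\<lambda>_. 0) has_real_derivative 0) (at x)" by simp
    then have "(flat_bump r m p has_real_derivative 0) (at x)"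
    proof (rule has_field_derivative_transform_within_open)
      show "open (- {-r..r})" by auto
    qed (use 2 in \<open>auto simp: flat_bump_def\<close>)
    then show ?thesis using 2 by (simp add: flat_bump_def)
  next
    case 3
    obtain B where B: "B > 0" "\<And>y. \<bar>y\<bar> \<le> r \<Longrightarrow> \<bar>poly p y\<bar> \<le> B"
    proof -
      have "bounded (poly p ` {-r..r})"
        by (intro compact_imp_bounded compact_continuous_image) (auto intro!: continuous_intros)
      then show thesis using that unfolding bounded_pos by (auto simp: abs_le_iff)
    qed
    define K where "K = B * (fact (m + 2) * (2 * r)\<^sup>2)"
    have K: "K > 0" using B r by (simp add: K_def)
    \<comment> \<open>A quadratic bound at the edge of the support gives derivative \<open>0\<close> there.\<close>
    have quad: "\<bar>flat_bump r m p y\<bar> \<le> K * \<bar>y - x\<bar>\<^sup>2" for y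
    proof (cases "\<bar>y\<bar> < r")
      case True
      define u where "u = r\<^sup>2 - y\<^sup>2"
      have ueq: "u = (r - \<bar>y\<bar>) * (r + \<bar>y\<bar>)" by (simp add: u_def power2_eq_square algebra_simps)
      then have u: "u > 0" using True r by simp
      \<comment> \<open>Since \<open>\<bar>x\<bar> = r\<close>, the factor
        \<open>r - \<bar>y\<bar>\<close> is at most \<open>\<bar>y - x\<bar>\<close>, and
        \<open>r + \<bar>y\<bar>\<close> is at most \<open>2 * r\<close>. This explains the factor
        \<open>(2 * r)\<^sup>2\<close> in \<open>K\<close>.\<close>
      have "u \<le> \<bar>y - x\<bar> * (2 * r)" unfolding ueq using True 3 by (intro mult_mono) auto
      then have "u\<^sup>2 \<le> (2 * r)\<^sup>2 * \<bar>y - x\<bar>\<^sup>2" using u by (metis mult.commute power_mono power_mult_distrib less_imp_le)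
      then have "fact (m + 2) * u\<^sup>2 \<le> fact (m + 2) * ((2 * r)\<^sup>2 * \<bar>y - x\<bar>\<^sup>2)"
        by (intro mult_left_mono) auto
      with exp_minus_inverse_le[OF u, of m]
      have "exp (- 1 / u) / u ^ m \<le> fact (m + 2) * ((2 * r)\<^sup>2 * \<bar>y - x\<bar>\<^sup>2)" by linarith
      then have "\<bar>poly p y\<bar> * (exp (- 1 / u) / u ^ m) \<le> B * (fact (m + 2) * ((2 * r)\<^sup>2 * \<bar>y - x\<bar>\<^sup>2))"
        using B True u by (intro mult_mono) auto
      then show ?thesis using True u by (simp add: flat_bump_def u_def[symmetric] abs_mult K_def mult_ac)
    qed (use K in \<open>auto simp: flat_bump_def\<close>)
    have "((\<lambda>y. (flat_bump r m p y - flat_bump r m p x) / (y - x)) \<longlongrightarrow> 0) (at x)"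
    proof (rule Lim_null_comparison)
      show "eventually (\<lambda>y. norm ((flat_bump r m p y - flat_bump r m p x) / (y - x)) \<le> K * \<bar>y - x\<bar>) (at x)"
        using quad 3 by (auto simp: eventually_at_filter flat_bump_def divide_le_eq power2_eq_square mult_ac)
      show "((\<lambda>y. K * \<bar>y - x\<bar>) \<longlongrightarrow> 0) (at x)" by (auto intro!: tendsto_eq_intros)
    qed
    then show ?thesis using 3 by (simp add: has_field_derivative_iff flat_bump_def)
  qed
qed

text \<open>\<open>m'\<close> and \<open>p'\<close> are chosen before the centre \<open>c\<close>:
  one profile gives the derivatives of all translates, so that these derivatives depend continuously
  on \<open>c\<close> as well.\<close>

lemma flat_bump_shift_deriv:
  assumes "r > 0"
  shows "\<exists>m' p'. \<forall>c. deriv (\<lambda>t. flat_bump r m p (t - c)) = (\<lambda>t. flat_bump r m' p' (t - c))"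
proof (intro exI allI ext DERIV_imp_deriv)
  fix c t
  show "((\<lambda>t. flat_bump r m p (t - c)) has_real_derivative flat_bump r (m + 2) (pderiv p * [:r\<^sup>2, 0, -1:]\<^sup>2 +
      (smult (real m) [:r\<^sup>2, 0, -1:] - 1) * p * [:0, 2:]) (t - c)) (at t)"
    by (rule DERIV_chain'[OF _ flat_bump_derivative[OF assms], THEN DERIV_cong]) (auto intro!: derivative_eq_intros)
qed

lemma flat_bump_shift_differentiable:
  assumes "r > 0"
  shows "(\<lambda>t. flat_bump r m p (t - c)) field_differentiable at t"
proof -
  have "((\<lambda>t. t - c) has_real_derivative 1) (at t)" by (auto intro!: derivative_eq_intros)
  from DERIV_chain'[OF this flat_bump_derivative[OF assms]] show ?thesis
    unfolding field_differentiable_def by blast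
qed

lemma continuous_on_flat_bump: "r > 0 \<Longrightarrow> continuous_on S (flat_bump r m p)"
  by (rule DERIV_continuous_on[OF has_field_derivative_at_within[OF flat_bump_derivative]])

text \<open>Differentiation stays within the family, which gives smoothness of all orders;
  \<open>r < c\<close> keeps \<open>[c - r, c + r]\<close>, which contains the support, inside the
  positive half line.\<close>

lemma flat_bump_test_function:
  assumes "0 < r" "r < c"
  shows "(\<lambda>t. flat_bump r m p (t - c)) \<in> test_functions"
proof -
  have "\<exists>m' p'. (deriv ^^ k) (\<lambda>t. flat_bump r m p (t - c)) = (\<lambda>t. flat_bump r m' p' (t - c))" for k
  proof (induction k)
    case (Suc k)
    then show ?case using flat_bump_shift_deriv[OF assms(1)] by auto metis
  qed auto
  then have smooth: "(deriv ^^ k) (\<lambda>t. flat_bump r m p (t - c)) field_differentiable at x" for k x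
    using flat_bump_shift_differentiable[OF assms(1)] by metis
  have sub: "support (\<lambda>t. flat_bump r m p (t - c)) \<subseteq> {c - r..c + r}"
    unfolding support_def by (rule closure_minimal) (auto simp: flat_bump_def split: if_splits)
  moreover have "closed (support (\<lambda>t. flat_bump r m p (t - c)))" by (simp add: support_def)
  ultimately have "compact (support (\<lambda>t. flat_bump r m p (t - c)))"
    using compact_Int_closed[OF compact_Icc, of _ "c - r" "c + r"] by (metis Int_absorb1)
  with smooth sub assms show ?thesis by (auto simp: test_functions_def)
qed

text \<open>A bridge from the Lebesgue integral in \<open>regular_dist\<close> to the gauge integral
  over a compact interval, where the fundamental theorem and the Leibniz rule are applied.\<close>

lemma set_lebesgue_integral_supported_Icc:
  fixes g :: "real \<Rightarrow> real"
  assumes "continuous_on {a..b} g" "0 < a" "\<And>t. t > 0 \<Longrightarrow> t \<notin> {a..b} \<Longrightarrow> g t = 0"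
  shows "set_lebesgue_integral lebesgue {0<..} g = integral {a..b} g"
proof -
  have "set_lebesgue_integral lebesgue {0<..} g = set_lebesgue_integral lebesgue {a..b} g"
    unfolding set_lebesgue_integral_def
    by (rule Bochner_Integration.integral_cong) (use assms(2,3) in \<open>auto simp: indicator_def\<close>)
  also have "\<dots> = integral {a..b} g"
    using assms(1) by (intro set_lebesgue_integral_eq_integral absolutely_integrable_continuous_real)
  finally show ?thesis .
qed

text \<open>The \<open>c\<close>-derivative of \<open>\<integral> D(t) \<phi>(t - c) dt\<close> is \<open>- \<integral> D(t) \<phi>'(t - c) dt = 0\<close>.\<close>

lemma integral_shifted_bump_const:
  assumes r: "r > 0" and "p \<le> q" and D: "continuous_on {a..b} D"
    and zero: "\<And>c. c \<in> {p..q} \<Longrightarrow> integral {a..b} (\<lambda>t. D t * deriv (\<lambda>t. flat_bump r m P (t - c)) t) = 0"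
  shows "integral {a..b} (\<lambda>t. D t * flat_bump r m P (t - p)) = integral {a..b} (\<lambda>t. D t * flat_bump r m P (t - q))"
proof -
  obtain m' P' where der: "deriv (\<lambda>t. flat_bump r m P (t - c)) = (\<lambda>t. flat_bump r m' P' (t - c))" for c
    using flat_bump_shift_deriv[OF r] by metis
  \<comment> \<open>The centre \<open>0\<close> turns the derivative of the translates into that of
    the profile itself, to which the chain rule in \<open>c\<close> is then applied.\<close>
  have "(flat_bump r m P has_real_derivative flat_bump r m' P' x) (at x)" for x
    using flat_bump_derivative[OF r, of m P x] der[of 0] DERIV_imp_deriv by fastforce
  then have shift: "((\<lambda>c. flat_bump r m P (t - c)) has_real_derivative - flat_bump r m' P' (t - c)) (at c)" for c t
    by (rule DERIV_chain'[rotated, THEN DERIV_cong]) (auto intro!: derivative_eq_intros)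
  note cb = continuous_on_compose2[OF continuous_on_flat_bump[OF r, of UNIV]]
  have bc: "continuous_on S (\<lambda>t. flat_bump r m P (t - c))" for S c
    by (intro cb continuous_intros) auto
  have "((\<lambda>c. integral (cbox a b) (\<lambda>t. D t * flat_bump r m P (t - c))) has_real_derivative
      integral (cbox a b) (\<lambda>t. D t * - flat_bump r m' P' (t - c))) (at c within {p..q})"
    if c: "c \<in> {p..q}" for c
  proof (rule leibniz_rule_field_derivative)
    show "continuous_on ({p..q} \<times> cbox a b) (\<lambda>(c, t). D t * - flat_bump r m' P' (t - c))"
      unfolding split_beta
      by (intro continuous_intros cb continuous_on_compose2[OF D]) auto
    show "(\<lambda>t. D t * flat_bump r m P (t - c)) integrable_on cbox a b" for c
      using D by (intro integrable_continuous continuous_on_mult bc) simp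
    show "((\<lambda>c. D t * flat_bump r m P (t - c)) has_real_derivative D t * - flat_bump r m' P' (t - c)) (at c within {p..q})" for c t
      by (rule has_field_derivative_at_within[OF DERIV_cmult[OF shift]])
  qed (use c in auto)
  moreover have "integral (cbox a b) (\<lambda>t. D t * - flat_bump r m' P' (t - c)) = 0" if "c \<in> {p..q}" for c
    using zero[OF that] by (simp add: der)
  ultimately have "\<exists>k. \<forall>c\<in>{p..q}. integral (cbox a b) (\<lambda>t. D t * flat_bump r m P (t - c)) = k"
    by (intro has_field_derivative_zero_constant) auto
  then show ?thesis using \<open>p \<le> q\<close> by auto
qed

text \<open>The hypothesis \<open>zero\<close> says that the distributional derivative of
  \<open>D\<close> vanishes. Hence the integral \<open>J c\<close> of \<open>D\<close> against a
  bump moved to \<open>c\<close> agrees at \<open>p\<close> and \<open>q\<close>, and so does the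
  mass \<open>I c\<close> of the bump. For a narrow bump \<open>J c / I c\<close> is close to
  \<open>D c\<close>, which forces \<open>D p = D q\<close>.\<close>

lemma du_Bois_Reymond:
  fixes D :: "real \<Rightarrow> real"
  assumes D: "continuous_on {0<..} D"
    and zero: "\<And>\<phi>. \<phi> \<in> test_functions \<Longrightarrow> set_lebesgue_integral lebesgue {0<..} (\<lambda>t. D t * deriv \<phi> t) = 0"
    and "0 < p" "p \<le> q"
  shows "D p = D q"
proof -
  have "\<bar>D p - D q\<bar> \<le> 2 * \<epsilon>" if "\<epsilon> > 0" for \<epsilon>
  proof -
    have near: "\<exists>d>0. \<forall>t. \<bar>t - c\<bar> < d \<longrightarrow> \<bar>D t - D c\<bar> < \<epsilon>" if "c > 0" for c
    proof -
      have "isCont D c" using D that by (simp add: continuous_on_eq_continuous_at)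
      then show ?thesis using \<open>\<epsilon> > 0\<close> unfolding continuous_at_eps_delta dist_real_def by blast
    qed
    obtain d1 where d1: "d1 > 0" "\<And>t. \<bar>t - p\<bar> < d1 \<Longrightarrow> \<bar>D t - D p\<bar> < \<epsilon>" using near[of p] \<open>0 < p\<close> by auto
    obtain d2 where d2: "d2 > 0" "\<And>t. \<bar>t - q\<bar> < d2 \<Longrightarrow> \<bar>D t - D q\<bar> < \<epsilon>" using near[of q] \<open>0 < p\<close> \<open>p \<le> q\<close> by auto
    \<comment> \<open>\<open>d1\<close> and \<open>d2\<close> control the oscillation of
      \<open>D\<close> at \<open>p\<close> and \<open>q\<close>; \<open>p/2\<close> ensures that all
      bumps centred in \<open>[p,q]\<close> live in \<open>[p/2, p + q]\<close>.\<close>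
    define r where "r = min (p/2) (min d1 d2)"
    have r: "r > 0" "r \<le> p/2" "r \<le> d1" "r \<le> d2" using d1(1) d2(1) \<open>0 < p\<close> by (auto simp: r_def)
    define a b where "a = p/2" and "b = p + q"
    have a: "a > 0" using \<open>0 < p\<close> by (simp add: a_def)
    have Dab: "continuous_on {a..b} D" using a by (intro continuous_on_subset[OF D]) auto
    note cb = continuous_on_compose2[OF continuous_on_flat_bump[OF r(1), of UNIV]]
    define \<phi> where "\<phi> = (\<lambda>c t. flat_bump r 0 1 (t - c))"
    have \<phi>c: "continuous_on S (\<phi> c)" for S c unfolding \<phi>_def by (intro cb continuous_intros) auto
    have \<phi>0: "0 \<le> \<phi> c t" for c t by (simp add: \<phi>_def flat_bump_def)
    have \<phi>out: "\<phi> c t = 0" if "\<bar>t - c\<bar> \<ge> r" for c t using that by (simp add: \<phi>_def flat_bump_def)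
    have test: "\<phi> c \<in> test_functions" if "c \<in> {p..q}" for c
      unfolding \<phi>_def using that r by (intro flat_bump_test_function) auto
    have \<phi>der: "(\<phi> c has_real_derivative deriv (\<phi> c) t) (at t)" for c t
      unfolding \<phi>_def using flat_bump_shift_differentiable[OF r(1)] field_differentiable_derivI by blast
    obtain m' P' where der: "deriv (\<phi> c) = (\<lambda>t. flat_bump r m' P' (t - c))" for c
      unfolding \<phi>_def using flat_bump_shift_deriv[OF r(1)] by metis
    have d\<phi>c: "continuous_on S (deriv (\<phi> c))" for S c unfolding der by (intro cb continuous_intros) auto
    define J where "J = (\<lambda>c. integral {a..b} (\<lambda>t. D t * \<phi> c t))"
    define I where "I = (\<lambda>c. integral {a..b} (\<phi> c))"
    have "J p = J q" unfolding J_def \<phi>_def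
    proof (rule integral_shifted_bump_const[OF r(1) \<open>p \<le> q\<close> Dab])
      fix c assume c: "c \<in> {p..q}"
      have "set_lebesgue_integral lebesgue {0<..} (\<lambda>t. D t * deriv (\<phi> c) t) = integral {a..b} (\<lambda>t. D t * deriv (\<phi> c) t)"
        using c r a by (intro set_lebesgue_integral_supported_Icc continuous_intros Dab d\<phi>c)
          (auto simp: der flat_bump_def a_def b_def)
      then show "integral {a..b} (\<lambda>t. D t * deriv (\<lambda>t. flat_bump r 0 1 (t - c)) t) = 0"
        using zero[OF test[OF c]] by (simp add: \<phi>_def)
    qed
    \<comment> \<open>The same translation argument with the constant \<open>1\<close> in place of
      \<open>D\<close>: the derivative of a bump has integral \<open>0\<close> because the bump
      vanishes at \<open>a\<close> and \<open>b\<close>.\<close>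
    have "I p = I q"
    proof -
      have "integral {a..b} (\<lambda>t. 1 * deriv (\<lambda>t. flat_bump r 0 1 (t - c)) t) = 0" if c: "c \<in> {p..q}" for c
      proof -
        have "(deriv (\<phi> c) has_integral (\<phi> c b - \<phi> c a)) {a..b}"
          using \<open>0 < p\<close> \<open>p \<le> q\<close>
          by (intro fundamental_theorem_of_calculus)
            (auto simp: a_def b_def has_real_derivative_iff_has_vector_derivative[symmetric] intro!: has_field_derivative_at_within[OF \<phi>der])
        moreover have "\<phi> c b = 0" "\<phi> c a = 0" using c r by (auto simp: \<phi>out a_def b_def)
        ultimately show ?thesis by (simp add: \<phi>_def integral_unique)
      qed
      from integral_shifted_bump_const[OF r(1) \<open>p \<le> q\<close> _ this] show ?thesis
        by (simp add: I_def \<phi>_def)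
    qed
    have close: "\<bar>J c - D c * I c\<bar> \<le> \<epsilon> * I c" if Dc: "\<And>t. \<bar>t - c\<bar> < r \<Longrightarrow> \<bar>D t - D c\<bar> < \<epsilon>" for c
    proof -
      have "J c - D c * I c = integral {a..b} (\<lambda>t. (D t - D c) * \<phi> c t)"
        using Dab \<phi>c
        by (simp add: J_def I_def left_diff_distrib integral_diff integrable_continuous_real continuous_intros flip: integral_mult_right)
      moreover have "norm (integral {a..b} (\<lambda>t. (D t - D c) * \<phi> c t)) \<le> integral {a..b} (\<lambda>t. \<epsilon> * \<phi> c t)"
      proof (rule integral_norm_bound_integral)
        show "norm ((D t - D c) * \<phi> c t) \<le> \<epsilon> * \<phi> c t" for t
          using Dc[of t] \<phi>0[of c t] \<phi>out[of t c]
          by (cases "\<bar>t - c\<bar> < r") (auto simp: abs_mult intro!: mult_right_mono)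
      qed (auto intro!: integrable_continuous_real continuous_intros Dab \<phi>c)
      ultimately show ?thesis by (simp add: I_def)
    qed
    \<comment> \<open>A nonnegative continuous function with integral \<open>0\<close> vanishes
      identically, but the bump is \<open>exp (- 1 / r^2)\<close> at its centre.\<close>
    have "I p > 0"
    proof -
      have "I p \<ge> 0" unfolding I_def using \<phi>0 by (intro integral_nonneg integrable_continuous_real \<phi>c)
      moreover have "I p \<noteq> 0"
      proof
        assume "I p = 0"
        moreover have "a < b" "p \<in> {a..b}" using \<open>0 < p\<close> \<open>p \<le> q\<close> by (auto simp: a_def b_def)
        ultimately have "\<phi> p p = 0" unfolding I_def
          using integral_eq_0_iff[OF \<phi>c[of "{a..b}" p]] \<phi>0 by auto
        then show False using r(1) by (simp add: \<phi>_def flat_bump_def)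
      qed
      ultimately show ?thesis by simp
    qed
    have "\<bar>J p - D p * I p\<bar> \<le> \<epsilon> * I p" "\<bar>J p - D q * I p\<bar> \<le> \<epsilon> * I p"
      using close[of p] close[of q] d1 d2 r \<open>I p = I q\<close> \<open>J p = J q\<close> by auto
    then have "\<bar>D p * I p - D q * I p\<bar> \<le> 2 * \<epsilon> * I p" by linarith
    moreover have "\<bar>D p * I p - D q * I p\<bar> = \<bar>D p - D q\<bar> * I p"
      using \<open>I p > 0\<close> by (simp add: abs_mult flip: left_diff_distrib)
    ultimately show ?thesis using \<open>I p > 0\<close> by simp
  qed
  \<comment> \<open>With this \<open>\<epsilon>\<close> the difference is at most half of itself,
    hence zero.\<close>
  from this[of "\<bar>D p - D q\<bar> / 4"] show ?thesis by (cases "D p = D q") auto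
qed

section \<open>Distributions and uniqueness of primitives\<close>

lemma test_functionD:
  assumes "\<phi> \<in> test_functions"
  shows "(\<phi> has_real_derivative deriv \<phi> t) (at t)" "continuous_on S \<phi>" "continuous_on S (deriv \<phi>)"
proof -
  have smooth: "(deriv ^^ k) \<phi> field_differentiable at x" for k x
    using assms by (simp add: test_functions_def)
  show "(\<phi> has_real_derivative deriv \<phi> t) (at t)"
    using smooth[of 0 t] by (simp add: field_differentiable_derivI)
  have "continuous_on S ((deriv ^^ k) \<phi>)" for k
    by (simp add: continuous_at_imp_continuous_on field_differentiable_imp_continuous_at smooth)
  from this[of 0] this[of 1] show "continuous_on S \<phi>" "continuous_on S (deriv \<phi>)" by simp_all
qed

lemma zero_off_support:
  assumes "x \<notin> support \<phi>"
  shows "\<phi> x = 0" "deriv \<phi> x = 0"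
proof -
  have zero: "\<phi> y = 0" if "y \<in> - support \<phi>" for y
    using that closure_subset[of "{x. \<phi> x \<noteq> 0}"] by (auto simp: support_def)
  then show "\<phi> x = 0" using assms by simp
  have "((\<lambda>_. 0) has_real_derivative 0) (at x)" by simp
  then have "(\<phi> has_real_derivative 0) (at x)"
  proof (rule has_field_derivative_transform_within_open)
    show "open (- support \<phi>)" by (simp add: support_def open_Compl)
  qed (use assms zero in auto)
  then show "deriv \<phi> x = 0" by (rule DERIV_imp_deriv)
qed

text \<open>The support is enclosed with a margin on both sides, so that \<open>\<phi>\<close> and
  its derivative also vanish at \<open>a\<close> and \<open>b\<close> and boundary terms drop out of
  integrations by parts.\<close>

lemma test_function_interval:
  assumes "\<phi> \<in> test_functions"
  obtains a b where "0 < a" "a \<le> b"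
    "\<And>t. t \<notin> {a<..<b} \<Longrightarrow> \<phi> t = 0" "\<And>t. t \<notin> {a<..<b} \<Longrightarrow> deriv \<phi> t = 0"
proof -
  have S: "compact (support \<phi>)" "support \<phi> \<subseteq> {0<..}" using assms by (auto simp: test_functions_def)
  have "\<exists>a b. 0 < a \<and> a \<le> b \<and> support \<phi> \<subseteq> {a<..<b}"
  proof (cases "support \<phi> = {}")
    case True
    then show ?thesis by (intro exI[of _ 1]) auto
  next
    case False
    obtain s where s: "s \<in> support \<phi>" "\<And>t. t \<in> support \<phi> \<Longrightarrow> s \<le> t"
      using compact_attains_inf[OF S(1) False] by blast
    obtain u where u: "\<And>t. t \<in> support \<phi> \<Longrightarrow> t \<le> u"
      using compact_attains_sup[OF S(1) False] by blast
    have "s > 0" using s S by auto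
    then show ?thesis using s u u[OF s(1)] by (intro exI[of _ "s/2"] exI[of _ "u+1"]) force
  qed
  then show thesis using that zero_off_support by blast
qed

lemma deriv_test_function:
  assumes "\<phi> \<in> test_functions"
  shows "deriv \<phi> \<in> test_functions"
proof -
  have sub: "support (deriv \<phi>) \<subseteq> support \<phi>"
    unfolding support_def[of "deriv \<phi>"]
    by (rule closure_minimal) (use zero_off_support(2) in \<open>auto simp: support_def\<close>)
  have "compact (support \<phi> \<inter> support (deriv \<phi>))"
    using assms by (intro compact_Int_closed) (auto simp: test_functions_def support_def)
  moreover have "(deriv ^^ k) (deriv \<phi>) field_differentiable at x" for k x
    using assms by (auto simp: test_functions_def simp flip: funpow_Suc_right[THEN fun_cong, unfolded comp_apply]
        elim: allE[of _ "Suc k"])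
  ultimately show ?thesis using sub assms by (auto simp: test_functions_def Int_absorb1)
qed

lemma test_function_lincomb:
  assumes "\<phi> \<in> test_functions" "\<psi> \<in> test_functions"
  shows "(\<lambda>x. a * \<phi> x + b * \<psi> x) \<in> test_functions"
proof -
  let ?f = "\<lambda>x. a * \<phi> x + b * \<psi> x"
  have smooth: "(deriv ^^ k) \<phi> field_differentiable at x" "(deriv ^^ k) \<psi> field_differentiable at x" for k x
    using assms by (simp_all add: test_functions_def)
  have iter: "(deriv ^^ k) ?f = (\<lambda>x. a * (deriv ^^ k) \<phi> x + b * (deriv ^^ k) \<psi> x)" for k
  proof (induction k)
    case (Suc k)
    have "((\<lambda>x. a * (deriv ^^ k) \<phi> x + b * (deriv ^^ k) \<psi> x) has_real_derivative
        a * (deriv ^^ Suc k) \<phi> x + b * (deriv ^^ Suc k) \<psi> x) (at x)" for x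
      using smooth[of k x] by (auto dest!: field_differentiable_derivI intro!: derivative_eq_intros)
    then show ?case using Suc by (auto intro!: DERIV_imp_deriv)
  qed simp
  have sub: "support ?f \<subseteq> support \<phi> \<union> support \<psi>"
    unfolding support_def[of ?f]
  proof (rule closure_minimal)
    show "{x. a * \<phi> x + b * \<psi> x \<noteq> 0} \<subseteq> support \<phi> \<union> support \<psi>"
      using zero_off_support(1)[of _ \<phi>] zero_off_support(1)[of _ \<psi>] by force
  qed (simp add: support_def closed_Un)
  have "compact ((support \<phi> \<union> support \<psi>) \<inter> support ?f)"
    using assms by (intro compact_Int_closed compact_Un) (auto simp: test_functions_def support_def)
  then have "compact (support ?f)" using sub by (simp add: Int_absorb1)
  moreover have "(deriv ^^ k) ?f field_differentiable at x" for k x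
    unfolding iter using smooth by (intro field_differentiable_add field_differentiable_mult) auto
  ultimately show ?thesis using sub assms unfolding test_functions_def by blast
qed

section \<open>Distributions given by functions\<close>

text \<open>For continuity, the difference of the values at \<open>\<phi> n\<close> and
  \<open>\<psi>\<close> is at most the supremum of \<open>\<bar>\<phi> n - \<psi>\<bar>\<close>
  times the \<open>L^1\<close> norm of \<open>h\<close>. Boundedness of test functions makes all
  products integrable.\<close>

lemma regular_dist_in_distributions:
  assumes h: "h absolutely_integrable_on {0<..}"
  shows "regular_dist h \<in> distributions"
proof -
  have int: "set_integrable lebesgue {0<..} (\<lambda>t. h t * \<phi> t)" if \<phi>: "\<phi> \<in> test_functions" for \<phi>
  proof -
    obtain a b where ab: "0 < a" "a \<le> b" "\<And>t. t \<notin> {a<..<b} \<Longrightarrow> \<phi> t = 0" "\<And>t. t \<notin> {a<..<b} \<Longrightarrow> deriv \<phi> t = 0"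
      by (rule test_function_interval[OF \<phi>]) (rule that)
    have "bounded (\<phi> ` {a..b})"
      by (intro compact_imp_bounded compact_continuous_image test_functionD(2)[OF \<phi>]) simp
    then obtain B where B: "B > 0" "\<And>t. t \<in> {a..b} \<Longrightarrow> \<bar>\<phi> t\<bar> \<le> B" unfolding bounded_pos by auto
    then have B': "\<bar>\<phi> t\<bar> \<le> B" for t using ab(3)[of t] by (cases "t \<in> {a<..<b}") auto
    have meas: "\<phi> \<in> borel_measurable lebesgue"
      using borel_measurable_continuous_onI[OF test_functionD(2)[OF \<phi>]]
      by (simp add: measurable_completion)
    show ?thesis
    proof (rule set_integrable_bound[of _ _ "\<lambda>t. B * h t"])
      show "set_integrable lebesgue {0<..} (\<lambda>t. B * h t)" using h by simp
      have "(\<lambda>t. indicator {0<..} t *\<^sub>R h t) \<in> borel_measurable lebesgue"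
        using h unfolding set_integrable_def by (rule borel_measurable_integrable)
      then have "(\<lambda>t. (indicator {0<..} t *\<^sub>R h t) * \<phi> t) \<in> borel_measurable lebesgue"
        using meas by (rule borel_measurable_times)
      then show "set_borel_measurable lebesgue {0<..} (\<lambda>t. h t * \<phi> t)"
        by (simp add: set_borel_measurable_def mult.assoc)
    qed (use B' B in \<open>auto simp: abs_mult mult.commute[of "\<bar>h _\<bar>"] intro!: mult_right_mono\<close>)
  qed
  have "(\<lambda>n. regular_dist h (\<phi> n)) \<longlonglongrightarrow> regular_dist h \<psi>"
    if \<phi>: "range \<phi> \<subseteq> test_functions" and \<psi>: "\<psi> \<in> test_functions" and lim: "test_tendsto \<phi> \<psi>" for \<phi> \<psi>
  proof (rule LIMSEQ_I)
    fix \<epsilon> :: real assume "\<epsilon> > 0"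
    define L where "L = set_lebesgue_integral lebesgue {0<..} (\<lambda>t. \<bar>h t\<bar>)"
    have "L \<ge> 0" unfolding L_def set_lebesgue_integral_def by (intro Bochner_Integration.integral_nonneg) auto
    define \<eta> where "\<eta> = \<epsilon> / (L + 1)"
    have \<eta>: "\<eta> > 0" "\<eta> * L < \<epsilon>" using \<open>\<epsilon> > 0\<close> \<open>L \<ge> 0\<close> by (auto simp: \<eta>_def field_simps)
    \<comment> \<open>The instance \<open>k = 0\<close>: uniform convergence of the test functions
      themselves.\<close>
    have "uniform_limit UNIV \<phi> \<psi> sequentially"
      using lim[unfolded test_tendsto_def, THEN conjunct2, rule_format, of 0] by simp
    then obtain N where N: "\<And>n t. n \<ge> N \<Longrightarrow> \<bar>\<phi> n t - \<psi> t\<bar> < \<eta>"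
      using \<eta>(1) unfolding uniform_limit_iff eventually_sequentially dist_real_def by fast
    have "norm (regular_dist h (\<phi> n) - regular_dist h \<psi>) < \<epsilon>" if "n \<ge> N" for n
    proof -
      have \<phi>n: "\<phi> n \<in> test_functions" using \<phi> by auto
      have "regular_dist h (\<phi> n) - regular_dist h \<psi> = set_lebesgue_integral lebesgue {0<..} (\<lambda>t. h t * \<phi> n t - h t * \<psi> t)"
        using \<phi>n \<psi> int by (simp add: regular_dist_def)
      also have "\<bar>\<dots>\<bar> \<le> set_lebesgue_integral lebesgue {0<..} (\<lambda>t. \<bar>h t * \<phi> n t - h t * \<psi> t\<bar>)"
        unfolding set_lebesgue_integral_def
        by (intro order_trans[OF integral_abs_bound]) (simp add: abs_mult)
      also have "\<dots> \<le> set_lebesgue_integral lebesgue {0<..} (\<lambda>t. \<eta> * \<bar>h t\<bar>)"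
      proof (rule set_integral_mono)
        show "\<bar>h t * \<phi> n t - h t * \<psi> t\<bar> \<le> \<eta> * \<bar>h t\<bar>" for t
          using mult_right_mono[OF less_imp_le[OF N[OF that, of t]], of "\<bar>h t\<bar>"]
          by (simp add: mult.commute[of _ "\<bar>h t\<bar>"] flip: right_diff_distrib abs_mult)
      qed (use int \<phi>n \<psi> h in \<open>auto intro!: set_integrable_abs set_integral_diff(1)\<close>)
      also have "\<dots> = \<eta> * L" by (simp add: L_def)
      finally show ?thesis using \<eta>(2) by simp
    qed
    then show "\<exists>N. \<forall>n\<ge>N. norm (regular_dist h (\<phi> n) - regular_dist h \<psi>) < \<epsilon>" by blast
  qed
  moreover have "regular_dist h (\<lambda>x. a * \<phi> x + b * \<psi> x) = a * regular_dist h \<phi> + b * regular_dist h \<psi>"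
    if "\<phi> \<in> test_functions" "\<psi> \<in> test_functions" for \<phi> \<psi> a b
  proof -
    have "regular_dist h (\<lambda>x. a * \<phi> x + b * \<psi> x) =
        set_lebesgue_integral lebesgue {0<..} (\<lambda>t. a * (h t * \<phi> t) + b * (h t * \<psi> t))"
      using that by (simp add: regular_dist_def test_function_lincomb algebra_simps)
    also have "\<dots> = a * regular_dist h \<phi> + b * regular_dist h \<psi>"
      using that int by (subst set_integral_add(2)) (simp_all add: regular_dist_def)
    finally show ?thesis .
  qed
  ultimately show ?thesis by (simp add: distributions_def regular_dist_def[of h])
qed

lemma regular_dist_eq_integral:
  assumes "\<phi> \<in> test_functions" "continuous_on {0<..} F" "0 < a"
    "\<And>t. t \<notin> {a<..<b} \<Longrightarrow> \<phi> t = 0"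
  shows "regular_dist F \<phi> = integral {a..b} (\<lambda>t. F t * \<phi> t)"
  unfolding regular_dist_def restrict_apply'[OF assms(1)]
proof (rule set_lebesgue_integral_supported_Icc)
  show "continuous_on {a..b} (\<lambda>t. F t * \<phi> t)"
    using assms by (intro continuous_intros test_functionD(2)[OF assms(1)] continuous_on_subset[OF assms(2)]) auto
qed (use assms in auto)

text \<open>Integration by parts: \<open>h * \<phi> + F * deriv \<phi>\<close> is the derivative of
  \<open>F * \<phi>\<close>, which vanishes at both ends of an interval around the support.\<close>

lemma regular_dist_deriv:
  assumes der: "\<And>t. t > 0 \<Longrightarrow> (F has_real_derivative h t) (at t)" and h: "continuous_on {0<..} h"
  shows "regular_dist h = dist_deriv (regular_dist F)"
proof (rule ext)
  fix \<phi>
  show "regular_dist h \<phi> = dist_deriv (regular_dist F) \<phi>"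
  proof (cases "\<phi> \<in> test_functions")
    case True
    obtain a b where ab: "0 < a" "a \<le> b" "\<And>t. t \<notin> {a<..<b} \<Longrightarrow> \<phi> t = 0" "\<And>t. t \<notin> {a<..<b} \<Longrightarrow> deriv \<phi> t = 0"
      by (rule test_function_interval[OF True]) (rule that)
    have F: "continuous_on {0<..} F" using der DERIV_isCont by (intro continuous_at_imp_continuous_on) auto
    have "((\<lambda>t. h t * \<phi> t + F t * deriv \<phi> t) has_integral F b * \<phi> b - F a * \<phi> a) {a..b}"
      using ab(1,2)
      by (intro fundamental_theorem_of_calculus)
        (auto simp flip: has_real_derivative_iff_has_vector_derivative
          intro!: has_field_derivative_at_within[OF DERIV_mult'[OF der test_functionD(1)[OF True], THEN DERIV_cong]])
    then have "integral {a..b} (\<lambda>t. h t * \<phi> t + F t * deriv \<phi> t) = 0" using ab(3)[of a] ab(3)[of b] by (simp add: integral_unique)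
    moreover have "integral {a..b} (\<lambda>t. h t * \<phi> t + F t * deriv \<phi> t) =
        integral {a..b} (\<lambda>t. h t * \<phi> t) + integral {a..b} (\<lambda>t. F t * deriv \<phi> t)"
      using ab(1) by (intro integral_add integrable_continuous_real continuous_on_mult test_functionD[OF True] continuous_on_subset[OF h] continuous_on_subset[OF F]) auto
    ultimately show ?thesis
      using True regular_dist_eq_integral[OF True h ab(1,3)] regular_dist_eq_integral[OF deriv_test_function[OF True] F ab(1,4)]
      by (simp add: dist_deriv_def)
  qed (simp add: regular_dist_def dist_deriv_def)
qed

section \<open>Uniqueness of the primitive\<close>

lemma continuous_on_ereal_half_line:
  fixes F :: "ereal \<Rightarrow> real"
  assumes "continuous_on {0..\<infinity>} F"
  shows "continuous_on {0..} (\<lambda>t. F (ereal t))"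
  by (rule continuous_on_compose2[OF assms]) (auto intro!: continuous_intros)

lemma tendsto_ereal_at_top:
  fixes F :: "ereal \<Rightarrow> real"
  assumes "continuous_on {0..\<infinity>} F"
  shows "((\<lambda>t. F (ereal t)) \<longlongrightarrow> F \<infinity>) at_top"
proof (rule continuous_on_tendsto_compose[OF assms])
  show "(ereal \<longlongrightarrow> \<infinity>) at_top"
    by (simp add: tendsto_PInfty eventually_gt_at_top)
  show "eventually (\<lambda>t. ereal t \<in> {0..\<infinity>}) at_top"
    using eventually_ge_at_top[of 0] by eventually_elim auto
qed simp

text \<open>The difference \<open>D\<close> has distributional derivative zero, so it is constant on
  the open half line. The common value \<open>0\<close> at \<open>0\<close> and continuity there
  make it zero, continuity at \<open>\<infinity>\<close> gives equality there, and extensionality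
  settles all other arguments.\<close>

lemma is_primitive_unique:
  assumes F: "is_primitive f F" and G: "is_primitive f G"
  shows "F = G"
proof -
  have cF: "continuous_on {0..\<infinity>} F" "F 0 = 0" "F \<in> extensional {0..\<infinity>}"
    and cG: "continuous_on {0..\<infinity>} G" "G 0 = 0" "G \<in> extensional {0..\<infinity>}"
    using F G by (auto simp: is_primitive_def primitives_def)
  note cF' = continuous_on_ereal_half_line[OF cF(1)] and cG' = continuous_on_ereal_half_line[OF cG(1)]
  define D where "D = (\<lambda>t. F (ereal t) - G (ereal t))"
  have cD: "continuous_on {0..} D" unfolding D_def by (intro continuous_intros cF' cG')
  have pF: "continuous_on {0<..} (\<lambda>t. F (ereal t))" by (rule continuous_on_subset[OF cF']) auto
  have pG: "continuous_on {0<..} (\<lambda>t. G (ereal t))" by (rule continuous_on_subset[OF cG']) auto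
  have pD: "continuous_on {0<..} D" by (rule continuous_on_subset[OF cD]) auto
  have const: "D p = D q" if "0 < p" "p \<le> q" for p q
  proof (rule du_Bois_Reymond[OF pD _ that])
    fix \<phi> assume \<phi>: "\<phi> \<in> test_functions"
    obtain a b where ab: "0 < a" "a \<le> b" "\<And>t. t \<notin> {a<..<b} \<Longrightarrow> \<phi> t = 0" "\<And>t. t \<notin> {a<..<b} \<Longrightarrow> deriv \<phi> t = 0"
      by (rule test_function_interval[OF \<phi>]) (rule that)
    note d\<phi> = deriv_test_function[OF \<phi>]
    have reg: "regular_dist H (deriv \<phi>) = integral {a..b} (\<lambda>t. H t * deriv \<phi> t)" if "continuous_on {0<..} H" for H
      by (rule regular_dist_eq_integral[OF d\<phi> that ab(1)]) (rule ab(4))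
    have "dist_deriv (regular_dist (\<lambda>t. F (ereal t))) \<phi> = dist_deriv (regular_dist (\<lambda>t. G (ereal t))) \<phi>"
      using F G by (simp add: is_primitive_def)
    then have "regular_dist (\<lambda>t. F (ereal t)) (deriv \<phi>) = regular_dist (\<lambda>t. G (ereal t)) (deriv \<phi>)"
      using \<phi> by (simp add: dist_deriv_def)
    moreover have "regular_dist D (deriv \<phi>) = regular_dist (\<lambda>t. F (ereal t)) (deriv \<phi>) - regular_dist (\<lambda>t. G (ereal t)) (deriv \<phi>)"
    proof -
      have "integral {a..b} (\<lambda>t. D t * deriv \<phi> t) =
          integral {a..b} (\<lambda>t. F (ereal t) * deriv \<phi> t - G (ereal t) * deriv \<phi> t)"
        by (simp add: D_def left_diff_distrib)
      also have "\<dots> = integral {a..b} (\<lambda>t. F (ereal t) * deriv \<phi> t) - integral {a..b} (\<lambda>t. G (ereal t) * deriv \<phi> t)"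
        using ab(1) by (intro integral_diff integrable_continuous_real continuous_on_mult test_functionD[OF \<phi>] continuous_on_subset[OF pF] continuous_on_subset[OF pG]) auto
      finally show ?thesis by (simp add: reg pF pG pD)
    qed
    ultimately show "set_lebesgue_integral lebesgue {0<..} (\<lambda>t. D t * deriv \<phi> t) = 0"
      using d\<phi> by (simp add: regular_dist_def)
  qed
  have zero: "D p = 0" if "p > 0" for p
  proof -
    have "(D \<longlongrightarrow> D 0) (at_right 0)"
      using cD by (auto simp: continuous_on intro: tendsto_within_subset)
    \<comment> \<open>To the left of \<open>p\<close> the function is already constant, so its right
      limit at \<open>0\<close> is \<open>D p\<close> as well as \<open>D 0\<close>.\<close>
    moreover have "eventually (\<lambda>t. D t = D p) (at_right 0)"
      using eventually_at_right_less[of 0] eventually_at_right_real[OF that]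
      by eventually_elim (auto intro!: const)
    ultimately have "D p = D 0"
      using tendsto_cong[of D "\<lambda>_. D p" "at_right 0"] tendsto_unique[OF trivial_limit_at_right_real tendsto_const] by blast
    then show ?thesis using cF(2) cG(2) by (simp add: D_def zero_ereal_def)
  qed
  have "F \<infinity> = G \<infinity>"
  proof (rule tendsto_unique[OF _ tendsto_ereal_at_top[OF cF(1)]])
    have "eventually (\<lambda>t. G (ereal t) = F (ereal t)) at_top"
      using eventually_gt_at_top[of 0] by eventually_elim (use zero in \<open>auto simp: D_def\<close>)
    then show "((\<lambda>t. F (ereal t)) \<longlongrightarrow> G \<infinity>) at_top"
      using tendsto_ereal_at_top[OF cG(1)] by (simp add: tendsto_cong)
  qed simp
  moreover have "F (ereal t) = G (ereal t)" if "t \<ge> 0" for t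
    using zero[of t] cF(2) cG(2) that by (cases "t = 0") (auto simp: D_def zero_ereal_def)
  ultimately have "F t = G t" if "t \<in> {0..\<infinity>}" for t using that by (cases t) auto
  then show ?thesis using cF(3) cG(3) by (intro extensionalityI)
qed

lemma primitive_eq: "is_primitive f F \<Longrightarrow> primitive f = F"
  unfolding primitive_def using is_primitive_unique by (intro the_equality)

section \<open>Smooth monotone majorants\<close>

text \<open>The mean of \<open>b\<close> over \<open>[t, 2 * t]\<close> after the substitution
  \<open>t * s\<close>. With the domain fixed, bounds and monotonicity in \<open>t\<close> are read
  off the integrand.\<close>

definition dyadic_mean :: "(real \<Rightarrow> real) \<Rightarrow> real \<Rightarrow> real" where
  "dyadic_mean b t = integral {1..2} (\<lambda>s. b (t * s))"

lemma mono_integrable: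
  fixes b :: "real \<Rightarrow> real"
  assumes "mono b"
  shows "b integrable_on {u..v}"
  using assms by (intro integrable_on_mono_on) (auto simp: mono_on_def mono_def)

lemma mono_scaled_integrable:
  fixes b :: "real \<Rightarrow> real"
  assumes b: "mono b" and "0 \<le> t"
  shows "(\<lambda>s. b (t * s)) integrable_on {u..v}"
  using assms by (intro mono_integrable) (auto simp: mono_def mult_left_mono)

text \<open>Both follow from \<open>t \<le> t * s \<le> 2 * t\<close>. The lower bound keeps a
  majorant a majorant; the upper one preserves the limit at \<open>0\<close> and later yields a
  nonnegative derivative.\<close>

lemma dyadic_mean_bounds:
  assumes b: "mono b" and t: "0 \<le> t"
  shows "b t \<le> dyadic_mean b t" "dyadic_mean b t \<le> b (2 * t)"
proof -
  have "integral {1..2::real} (\<lambda>s. b t) \<le> dyadic_mean b t" unfolding dyadic_mean_def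
    using t by (intro integral_le mono_scaled_integrable[OF b t] monoD[OF b]) (auto simp: mult_le_cancel_left1)
  then show "b t \<le> dyadic_mean b t" by simp
  have "dyadic_mean b t \<le> integral {1..2::real} (\<lambda>s. b (2 * t))" unfolding dyadic_mean_def
    using t by (intro integral_le mono_scaled_integrable[OF b t] monoD[OF b]) (auto simp: mult_left_mono mult.commute[of 2])
  then show "dyadic_mean b t \<le> b (2 * t)" by simp
qed

text \<open>Undoing the substitution gives the integral over \<open>[t, 2 * t]\<close>. As a
  difference of indefinite integrals from \<open>0\<close> it is accessible to continuity and
  differentiation in \<open>t\<close>.\<close>

lemma dyadic_mean_eq:
  assumes b: "mono b" and t: "0 < t"
  shows "dyadic_mean b t = (integral {0..2 * t} b - integral {0..t} b) / t"
proof -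
  have "(b has_integral integral {t..2 * t} b) {t..2 * t}"
    using mono_integrable[OF b] by (rule integrable_integral)
  from has_integral_stretch_real[OF this, of t] t
  have "((\<lambda>s. b (t * s)) has_integral integral {t..2 * t} b / t) {1..2}" by (simp add: image_divide_atLeastAtMost)
  moreover have "integral {0..t} b + integral {t..2 * t} b = integral {0..2 * t} b"
    using t by (intro Henstock_Kurzweil_Integration.integral_combine mono_integrable[OF b]) auto
  ultimately show ?thesis by (simp add: dyadic_mean_def integral_unique eq_diff_eq)
qed

text \<open>Averaging twice turns a merely monotone majorant into one that is \<open>C\<^sup>1\<close> on \<open>(0, \<infinity>)\<close>
  without leaving the following class.\<close>

definition modulus :: "(real \<Rightarrow> real) \<Rightarrow> bool" where
  "modulus b \<longleftrightarrow> mono b \<and> (\<forall>t\<le>0. b t = 0) \<and> (\<forall>t\<ge>1. b t = 1) \<and> (b \<longlongrightarrow> 0) (at_right 0)"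

text \<open>For positive \<open>t\<close> the mean is squeezed between \<open>b t\<close> and
  \<open>b (2 * t)\<close>, which transports the limit at \<open>0\<close> and the constant value
  from \<open>1\<close> on.\<close>

lemma modulus_dyadic_mean:
  assumes "modulus b"
  shows "modulus (dyadic_mean b)"
proof -
  have b: "mono b" "\<And>t. t \<le> 0 \<Longrightarrow> b t = 0" "\<And>t. t \<ge> 1 \<Longrightarrow> b t = 1" "(b \<longlongrightarrow> 0) (at_right 0)"
    using assms by (auto simp: modulus_def)
  have b0: "b t \<ge> 0" for t using monoD[OF b(1), of 0 t] monoD[OF b(1), of t 0] b(2)[of 0] b(2)[of t] by linarith
  have neg: "dyadic_mean b t = 0" if "t \<le> 0" for t
  proof -
    have "dyadic_mean b t = integral {1..2::real} (\<lambda>s. 0)" unfolding dyadic_mean_def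
      using that by (intro integral_cong b(2)) (auto simp: mult_nonpos_nonneg)
    then show ?thesis by simp
  qed
  have one: "dyadic_mean b t = 1" if "t \<ge> 1" for t
    using dyadic_mean_bounds[OF b(1), of t] that b(3)[of t] b(3)[of "2 * t"] by auto
  have "mono (dyadic_mean b)"
  proof (rule monoI)
    fix s t :: real assume "s \<le> t"
    show "dyadic_mean b s \<le> dyadic_mean b t"
    proof (cases "s \<le> 0")
      case True
      then have "dyadic_mean b s = 0" by (rule neg)
      moreover have "0 \<le> dyadic_mean b t"
        using neg[of t] dyadic_mean_bounds(1)[OF b(1), of t] b0[of t] by (cases "t \<le> 0") auto
      ultimately show ?thesis by simp
    next
      case False
      then show ?thesis unfolding dyadic_mean_def using \<open>s \<le> t\<close>
        by (intro integral_le mono_scaled_integrable[OF b(1)] monoD[OF b(1)]) (auto intro: mult_right_mono)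
    qed
  qed
  moreover have "(dyadic_mean b \<longlongrightarrow> 0) (at_right 0)"
  proof (rule real_tendsto_sandwich)
    show "eventually (\<lambda>t. 0 \<le> dyadic_mean b t) (at_right 0)"
      using eventually_at_right_less[of 0]
      by eventually_elim (use order_trans[OF b0 dyadic_mean_bounds(1)[OF b(1)]] in auto)
    show "eventually (\<lambda>t. dyadic_mean b t \<le> b (2 * t)) (at_right 0)"
      using eventually_at_right_less[of 0] by eventually_elim (simp add: dyadic_mean_bounds(2)[OF b(1)])
    have "filterlim (\<lambda>t. 2 * t) (at_right (0::real)) (at_right 0)"
      unfolding filterlim_at by (auto intro!: tendsto_eq_intros eventually_at_rightI[of 0 1])
    then show "((\<lambda>t. b (2 * t)) \<longlongrightarrow> 0) (at_right 0)" by (rule filterlim_compose[OF b(4)])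
  qed simp
  ultimately show ?thesis using neg one by (simp add: modulus_def)
qed

lemma isCont_integral_upto:
  fixes b :: "real \<Rightarrow> real"
  assumes "mono b" "x > 0"
  shows "isCont (\<lambda>u. integral {0..u} b) x"
  using indefinite_integral_continuous_1[OF mono_integrable[OF assms(1), of 0 "x + 1"]] assms(2)
  by (auto intro: continuous_on_interior)

text \<open>Averaging gains continuity from monotonicity: for \<open>t > 0\<close> the mean is a
  quotient built from indefinite integrals, which are continuous even if \<open>b\<close> jumps. At
  \<open>0\<close> both one-sided limits are \<open>0\<close>.\<close>

lemma isCont_dyadic_mean:
  assumes "modulus b"
  shows "isCont (dyadic_mean b) t"
proof -
  have b: "mono b" using assms by (simp add: modulus_def)
  have m: "\<And>t. t \<le> 0 \<Longrightarrow> dyadic_mean b t = 0" "(dyadic_mean b \<longlongrightarrow> 0) (at_right 0)"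
    using modulus_dyadic_mean[OF assms] by (auto simp: modulus_def)
  consider "t < 0" | "t = 0" | "t > 0" by linarith
  then show ?thesis
  proof cases
    case 1
    then have "eventually (\<lambda>s. dyadic_mean b s = 0) (nhds t)"
      using eventually_nhds_in_open[of "{..<0}" t] by (auto elim: eventually_mono simp: m(1))
    then show ?thesis by (simp add: isCont_cong)
  next
    case 2
    have "(dyadic_mean b \<longlongrightarrow> 0) (at_left 0)"
      by (rule tendsto_eventually) (auto simp: eventually_at_filter m(1))
    then show ?thesis using m 2 by (simp add: isCont_def filterlim_at_split)
  next
    case 3
    have "isCont (\<lambda>t. (integral {0..2 * t} b - integral {0..t} b) / t) t"
      using 3 by (intro continuous_intros isCont_o2[OF _ isCont_integral_upto[OF b], of t "\<lambda>t. 2 * t"] isCont_integral_upto[OF b]) auto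
    moreover have "eventually (\<lambda>s. dyadic_mean b s = (integral {0..2 * s} b - integral {0..s} b) / s) (nhds t)"
      using eventually_nhds_in_open[of "{0<..}" t] 3 by (auto elim: eventually_mono simp: dyadic_mean_eq[OF b])
    ultimately show ?thesis by (simp add: isCont_cong)
  qed
qed

text \<open>Once \<open>b\<close> is continuous, the indefinite integrals are differentiable, and in
  the quotient rule the original quotient reappears as the mean.\<close>

lemma dyadic_mean_deriv:
  assumes "mono b" "\<And>t. isCont b t" "t > 0"
  shows "(dyadic_mean b has_real_derivative (2 * b (2 * t) - b t - dyadic_mean b t) / t) (at t)"
proof -
  have K: "((\<lambda>u. integral {0..u} b) has_real_derivative b x) (at x)" if "x > 0" for x
  proof -
    have "((\<lambda>u. integral {0..u} b) has_real_derivative b x) (at x within {0..x + 1})"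
      using that assms(2) by (intro integral_has_real_derivative continuous_at_imp_continuous_on) auto
    then have "((\<lambda>u. integral {0..u} b) has_real_derivative b x) (at x within {0<..<x + 1})"
      by (rule DERIV_subset) auto
    then show ?thesis using that by (simp add: at_within_open[of x "{0<..<x + 1}"])
  qed
  have K2: "((\<lambda>t. integral {0..2 * t} b) has_real_derivative b (2 * t) * 2) (at t)"
    using assms(3) by (intro DERIV_chain'[OF _ K]) (auto intro!: derivative_eq_intros)
  have "((\<lambda>t. (integral {0..2 * t} b - integral {0..t} b) / t) has_real_derivative
      ((b (2 * t) * 2 - b t) * t - (integral {0..2 * t} b - integral {0..t} b) * 1) / (t * t)) (at t)"
    using assms(3) by (intro DERIV_divide DERIV_diff K K2 DERIV_ident) auto
  then have "((\<lambda>t. (integral {0..2 * t} b - integral {0..t} b) / t) has_real_derivative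
      (2 * b (2 * t) - b t - dyadic_mean b t) / t) (at t)"
    by (rule DERIV_cong) (use assms(3) in \<open>simp add: dyadic_mean_eq[OF assms(1)] field_simps\<close>)
  then show ?thesis
    by (rule has_field_derivative_transform_within_open[of _ _ _ "{0<..}"])
      (use assms(1,3) in \<open>auto simp: dyadic_mean_eq\<close>)
qed

text \<open>The envelope \<open>b\<close> is only monotone; its mean \<open>G\<close> is continuous,
  and the mean \<open>F\<close> of \<open>G\<close> is continuously differentiable on the positive
  half line. Each averaging preserves the lower bound \<open>A (1 / t)\<close>.\<close>

lemma smooth_modulus_majorant:
  fixes A :: "real \<Rightarrow> real"
  assumes A: "\<And>x. x > 0 \<Longrightarrow> 0 < A x \<and> A x < 1" and lim: "(A \<longlongrightarrow> 0) at_top"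
  obtains F h where "modulus F" "\<And>t. isCont F t"
    "\<And>t. t > 0 \<Longrightarrow> (F has_real_derivative h t) (at t)" "continuous_on {0<..} h"
    "\<And>t. t > 0 \<Longrightarrow> h t \<ge> 0" "\<And>x. x > 0 \<Longrightarrow> A x \<le> F (1 / x)"
proof -
  \<comment> \<open>The first branch avoids a supremum over the empty set. The value
    \<open>1\<close> from \<open>t = 1\<close> on, compatible with monotonicity because
    \<open>A < 1\<close>, makes the function constant near \<open>\<infinity>\<close>.\<close>
  define b where "b = (\<lambda>t::real. if t \<le> 0 then 0 else if t \<ge> 1 then 1 else (SUP s\<in>{0<..t}. A (1 / s)))"
  have bdd: "bdd_above ((\<lambda>s. A (1 / s)) ` {0<..t})" for t
    using A by (intro bdd_aboveI2[of _ _ 1] less_imp_le) simp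
  have b_le: "b t \<le> 1" for t
  proof -
    have "(SUP s\<in>{0<..t}. A (1 / s)) \<le> 1" if "0 < t"
      using A that by (intro cSUP_least less_imp_le) auto
    then show ?thesis by (simp add: b_def)
  qed
  have A_le: "A (1 / s) \<le> b t" if "0 < s" "s \<le> t" for s t
  proof -
    have "A (1 / s) < 1" using A that by simp
    then show ?thesis using that by (auto simp: b_def intro!: cSUP_upper2[OF bdd])
  qed
  have b_ge: "b t \<ge> 0" for t
    using A_le[of t t] A[of "1 / t"] by (cases "t \<le> 0") (auto simp: b_def intro: order_trans less_imp_le)
  have "mono b"
  proof (rule monoI)
    fix s t :: real assume "s \<le> t"
    consider "s \<le> 0" | "t \<ge> 1" | "0 < s" "t < 1" by linarith
    then show "b s \<le> b t"
    proof cases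
      case 1 then show ?thesis using b_ge[of t] by (simp add: b_def)
    next
      case 2 then show ?thesis using b_le[of s] by (simp add: b_def)
    next
      case 3
      then show ?thesis using \<open>s \<le> t\<close> by (auto simp: b_def intro!: cSUP_subset_mono bdd)
    qed
  qed
  moreover have "(b \<longlongrightarrow> 0) (at_right 0)"
  proof (rule tendstoI)
    fix e :: real assume "e > 0"
    then have "eventually (\<lambda>x. \<bar>A x\<bar> < e / 2) at_top"
      using tendstoD[OF lim, of "e / 2"] by simp
    then obtain X where X: "\<And>x. x \<ge> X \<Longrightarrow> \<bar>A x\<bar> < e / 2" by (auto simp: eventually_at_top_linorder)
    \<comment> \<open>\<open>M \<ge> 2\<close> gives \<open>d < 1\<close>, so that for
      \<open>t < d\<close> the branch of \<open>b\<close> with the supremum applies.\<close>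
    define M where "M = max X 2"
    have M: "M \<ge> X" "M \<ge> 2" by (auto simp: M_def)
    define d where "d = 1 / M"
    have d: "d > 0" "d < 1" using M by (auto simp: d_def)
    have small: "b t \<le> e / 2" if "0 < t" "t < d" for t
    proof -
      have "A (1 / s) \<le> e / 2" if s: "0 < s" "s \<le> t" for s
      proof -
        have "s \<le> 1 / M" using s \<open>t < d\<close> by (simp add: d_def)
        then have "1 / s \<ge> M" using s M by (simp add: field_simps)
        then have "1 / s \<ge> X" using M by simp
        from X[OF this] show ?thesis by simp
      qed
      then have "(SUP s\<in>{0<..t}. A (1 / s)) \<le> e / 2" using that by (intro cSUP_least) auto
      then show ?thesis using that d by (simp add: b_def)
    qed
    show "eventually (\<lambda>t. dist (b t) 0 < e) (at_right 0)"
      using eventually_at_right_real[OF d(1)]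
    proof eventually_elim
      case (elim t)
      then show ?case using small[of t] b_ge[of t] \<open>e > 0\<close> by auto
    qed
  qed
  ultimately have mod0: "modulus b" by (auto simp: modulus_def b_def)
  define G where "G = dyadic_mean b"
  define F where "F = dyadic_mean G"
  have modG: "modulus G" and modF: "modulus F" unfolding F_def G_def using modulus_dyadic_mean mod0 by blast+
  have mono: "mono b" "mono G" "mono F" using mod0 modG modF by (auto simp: modulus_def)
  have cG: "isCont G t" and cF: "isCont F t" for t
    unfolding F_def using isCont_dyadic_mean[OF mod0] isCont_dyadic_mean[OF modG] by (auto simp: G_def)
  define h where "h = (\<lambda>t. (2 * G (2 * t) - G t - F t) / t)"
  show thesis
  proof (rule that[OF modF cF, of h])
    show "(F has_real_derivative h t) (at t)" if "t > 0" for t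
      unfolding h_def F_def using mono(2) cG that by (rule dyadic_mean_deriv)
    show "continuous_on {0<..} h" unfolding h_def
      by (intro continuous_intros continuous_at_imp_continuous_on ballI cG cF isCont_o2[OF _ cG]) auto
    \<comment> \<open>Both \<open>G t\<close> and its mean \<open>F t\<close> are at most
      \<open>G (2 * t)\<close>.\<close>
    show "h t \<ge> 0" if "t > 0" for t
      using dyadic_mean_bounds(2)[OF mono(2), of t] monoD[OF mono(2), of t "2 * t"] that
      by (auto simp: h_def F_def intro!: divide_nonneg_pos)
    show "A x \<le> F (1 / x)" if "x > 0" for x
      using A_le[of "1 / x" "1 / x"] dyadic_mean_bounds(1)[OF mono(1), of "1 / x"]
        dyadic_mean_bounds(1)[OF mono(2), of "1 / x"] that by (simp add: F_def G_def)
  qed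
qed

section \<open>The Laplace transform\<close>

text \<open>An antiderivative is \<open>- (c + C * t + C / r) * exp (- r * t)\<close>, which tends
  to \<open>0\<close>. Upper bounds for the transform use \<open>a = 0\<close>, lower bounds use
  \<open>C = 0\<close>.\<close>

lemma affine_exp_integral:
  fixes c C r a :: real
  assumes "0 \<le> c" "0 \<le> C" "0 < r" "0 \<le> a"
  shows "set_integrable lborel (einterval (ereal a) \<infinity>) (\<lambda>t. (c + C * t) * r * exp (- r * t))"
    and "(LBINT t=ereal a..\<infinity>. (c + C * t) * r * exp (- r * t)) = (c + C * a + C / r) * exp (- r * a)"
proof -
  let ?f = "\<lambda>t. (c + C * t) * r * exp (- r * t)"
  let ?F = "\<lambda>t. - (c + C * t + C / r) * exp (- r * t)"
  have der: "(?F has_real_derivative ?f t) (at t)" for t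
    using \<open>0 < r\<close> by (auto intro!: derivative_eq_intros simp: field_simps)
  have rt: "filterlim (\<lambda>t. r * t) at_top at_top"
    using \<open>0 < r\<close> by (simp add: filterlim_tendsto_pos_mult_at_top[OF tendsto_const] filterlim_ident)
  \<comment> \<open>The antiderivative is rewritten with powers of \<open>r * t\<close> over
    \<open>exp (r * t)\<close> to match \<open>tendsto_power_div_exp_0\<close>.\<close>
  have "((\<lambda>t. - (c + C / r) * ((r * t) ^ 0 / exp (r * t)) - C / r * ((r * t) ^ 1 / exp (r * t)))
      \<longlongrightarrow> - (c + C / r) * 0 - C / r * 0) at_top"
    by (intro tendsto_intros filterlim_compose[OF tendsto_power_div_exp_0 rt])
  moreover have "(\<lambda>t. - (c + C / r) * ((r * t) ^ 0 / exp (r * t)) - C / r * ((r * t) ^ 1 / exp (r * t))) = ?F"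
    using \<open>0 < r\<close> by (auto simp: fun_eq_iff exp_minus field_simps)
  ultimately have B: "((?F \<circ> real_of_ereal) \<longlongrightarrow> 0) (at_left \<infinity>)" by (simp add: ereal_tendsto_simps1)
  have "isCont ?F a" using der DERIV_isCont by blast
  then have A: "((?F \<circ> real_of_ereal) \<longlongrightarrow> ?F a) (at_right (ereal a))"
    by (auto simp: ereal_tendsto_simps1 isCont_def intro: filterlim_mono at_le)
  have nonneg: "AE t in lborel. ereal a < ereal t \<longrightarrow> ereal t < \<infinity> \<longrightarrow> 0 \<le> ?f t" using assms by auto
  have cont: "isCont ?f t" for t by (intro continuous_intros)
  note FTC = interval_integral_FTC_nonneg[of "ereal a" \<infinity> ?F ?f, OF _ der cont nonneg A B]
  show "set_integrable lborel (einterval (ereal a) \<infinity>) ?f" using FTC(1) by simp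
  show "(LBINT t=ereal a..\<infinity>. ?f t) = (c + C * a + C / r) * exp (- r * a)" using FTC(2) by (simp add: algebra_simps)
qed

lemma laplace_kernel_deriv:
  fixes z :: complex
  shows "((\<lambda>t. exp (- z * of_real t)) has_vector_derivative - z * exp (- z * of_real t)) (at t)"
proof -
  have "((\<lambda>w. exp (- z * w)) has_field_derivative - z * exp (- z * of_real t)) (at (of_real t))"
    by (auto intro!: derivative_eq_intros)
  moreover have "(complex_of_real has_vector_derivative 1) (at t)"
    by (auto intro!: derivative_eq_intros)
  ultimately have "((\<lambda>w. exp (- z * w)) \<circ> complex_of_real has_vector_derivative 1 * (- z * exp (- z * of_real t))) (at t)"
    by (intro field_vector_diff_chain_at)
  then show ?thesis by (simp add: comp_def)
qed

text \<open>\<open>L\<close> stands for \<open>Re\<close> or \<open>Im\<close>, so both parts of the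
  transform are treated at once; \<open>k\<close> is the derivative of
  \<open>L (exp (- z * t))\<close>. The bound comes from
  \<open>\<bar>k t\<bar> \<le> norm z * exp (- Re z * t)\<close> and the integral of the affine
  majorant of \<open>F\<close>.\<close>

lemma laplace_weight_integral:
  fixes F :: "ereal \<Rightarrow> real" and L :: "complex \<Rightarrow> real"
  assumes F: "continuous_on {0..\<infinity>} F" and z: "Re z > 0"
    and L: "bounded_linear L" "\<And>w. \<bar>L w\<bar> \<le> norm w"
  defines "k \<equiv> \<lambda>t::real. L (- z * exp (- z * of_real t))"
  shows laplace_weight_RS: "RS_integral F (\<lambda>t. L (laplace_kernel z t)) 0 \<infinity> = (LBINT t=0..\<infinity>. F (ereal t) * k t)"
    and laplace_weight_bound: "\<And>c C. \<lbrakk>0 \<le> c; 0 \<le> C; \<And>t. 0 \<le> t \<Longrightarrow> \<bar>F (ereal t)\<bar> \<le> c + C * t\<rbrakk> \<Longrightarrow>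
      \<bar>LBINT t=0..\<infinity>. F (ereal t) * k t\<bar> \<le> norm z / Re z * (c + C / Re z)"
    and laplace_weight_integrable: "set_integrable lborel (einterval 0 \<infinity>) (\<lambda>t. F (ereal t) * k t)"
proof -
  have L0: "L 0 = 0" using L(1) by (rule linear_simps)
  have size: "norm (exp (- z * of_real t)) = exp (- Re z * t)" for t :: real by (simp add: norm_exp_eq_Re)
  have k_le: "\<bar>k t\<bar> \<le> norm z * exp (- Re z * t)" for t
    using L(2)[of "- z * exp (- z * of_real t)"] by (simp add: k_def norm_mult norm_exp_eq_Re)
  have kc: "continuous_on UNIV k" unfolding k_def
    by (intro bounded_linear.continuous_on[OF L(1)] continuous_intros)
  have kint: "set_integrable lborel (einterval 0 \<infinity>) k"
  \<comment> \<open>The shape \<open>1 + 0 * t\<close> matches \<open>affine_exp_integral\<close>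
    with \<open>c = 1\<close> and \<open>C = 0\<close>.\<close>
  proof (rule set_integrable_bound[of _ _ "\<lambda>t. norm z / Re z * ((1 + 0 * t) * Re z * exp (- Re z * t))"])
    show "set_integrable lborel (einterval 0 \<infinity>) (\<lambda>t. norm z / Re z * ((1 + 0 * t) * Re z * exp (- Re z * t)))"
      using affine_exp_integral(1)[of 1 0 "Re z" 0] z by (intro set_integrable_mult_right) (simp add: zero_ereal_def)
    show "set_borel_measurable lborel (einterval 0 \<infinity>) k"
      using borel_measurable_continuous_on_indicator[OF _ continuous_on_subset[OF kc]]
      by (simp add: set_borel_measurable_def)
  qed (use k_le z in auto)
  have "((\<lambda>t. L (exp (- z * of_real t))) \<longlongrightarrow> 0) at_top"
  proof (rule Lim_null_comparison)
    show "eventually (\<lambda>t. norm (L (exp (- z * of_real t))) \<le> exp (- (Re z * t))) at_top"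
      using L(2)[of "exp (- z * of_real _)"] unfolding size by simp
    have "filterlim (\<lambda>t. Re z * t) at_top at_top"
      using z by (simp add: filterlim_tendsto_pos_mult_at_top[OF tendsto_const] filterlim_ident)
    then show "((\<lambda>t. exp (- (Re z * t))) \<longlongrightarrow> 0) at_top"
      by (intro filterlim_compose[OF exp_at_bot] filterlim_compose[OF filterlim_uminus_at_bot_at_top])
  qed
  moreover have "((\<lambda>t. L (exp (- z * of_real t))) has_real_derivative k t) (at t)" for t
    unfolding k_def has_real_derivative_iff_has_vector_derivative
    by (rule bounded_linear.has_vector_derivative[OF L(1) laplace_kernel_deriv])
  ultimately have "RS_integral F (\<lambda>t. if t = \<infinity> then 0 else L (exp (- z * of_real (real_of_ereal t)))) 0 \<infinity>
      = (LBINT t=0..\<infinity>. F (ereal t) * k t)"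
    by (intro RS_integral_density[OF F _ _ kc kint]) auto
  \<comment> \<open>\<open>L 0 = 0\<close> moves \<open>L\<close> into the case distinction at
    \<open>\<infinity>\<close>.\<close>
  moreover have "(\<lambda>t. L (laplace_kernel z t)) = (\<lambda>t. if t = \<infinity> then 0 else L (exp (- z * of_real (real_of_ereal t))))"
    by (auto simp: laplace_kernel_def L0)
  ultimately show "RS_integral F (\<lambda>t. L (laplace_kernel z t)) 0 \<infinity> = (LBINT t=0..\<infinity>. F (ereal t) * k t)" by simp
  show Fk: "set_integrable lborel (einterval 0 \<infinity>) (\<lambda>t. F (ereal t) * k t)"
    by (rule set_integrable_times_continuous[OF F kc kint])
  fix c C :: real assume c: "0 \<le> c" "0 \<le> C" and F_le: "\<And>t. 0 \<le> t \<Longrightarrow> \<bar>F (ereal t)\<bar> \<le> c + C * t"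
  note ae = affine_exp_integral[OF c z, of 0]
  have "\<bar>LBINT t=0..\<infinity>. F (ereal t) * k t\<bar> \<le> (LBINT t:einterval 0 \<infinity>. \<bar>F (ereal t) * k t\<bar>)"
    unfolding set_lebesgue_integral_def interval_lebesgue_integral_def
    by (simp, intro order_trans[OF integral_abs_bound]) (simp add: abs_mult)
  also have "\<dots> \<le> (LBINT t:einterval 0 \<infinity>. norm z / Re z * ((c + C * t) * Re z * exp (- Re z * t)))"
  proof (rule set_integral_mono)
    show "set_integrable lborel (einterval 0 \<infinity>) (\<lambda>t. \<bar>F (ereal t) * k t\<bar>)" using Fk by (rule set_integrable_abs)
    show "set_integrable lborel (einterval 0 \<infinity>) (\<lambda>t. norm z / Re z * ((c + C * t) * Re z * exp (- Re z * t)))"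
      using ae(1) by (intro set_integrable_mult_right) (simp add: zero_ereal_def)
    fix t assume "t \<in> einterval 0 \<infinity>"
    then have "0 \<le> t" by (simp add: einterval_def)
    then have "\<bar>F (ereal t)\<bar> * \<bar>k t\<bar> \<le> (c + C * t) * (norm z * exp (- Re z * t))"
      using k_le F_le c by (intro mult_mono) auto
    then show "\<bar>F (ereal t) * k t\<bar> \<le> norm z / Re z * ((c + C * t) * Re z * exp (- Re z * t))"
      using z by (simp add: abs_mult mult_ac)
  qed
  also have "\<dots> = norm z / Re z * (LBINT t=ereal 0..\<infinity>. (c + C * t) * Re z * exp (- Re z * t))"
    unfolding set_integral_mult_right by (simp add: interval_lebesgue_integral_def zero_ereal_def)
  also have "\<dots> = norm z / Re z * (c + C / Re z)" using ae(2) by simp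
  finally show "\<bar>LBINT t=0..\<infinity>. F (ereal t) * k t\<bar> \<le> norm z / Re z * (c + C / Re z)" .
qed

lemma Re_Im_weight:
  "bounded_linear Re" "\<bar>Re w\<bar> \<le> norm w" "bounded_linear Im" "\<bar>Im w\<bar> \<le> norm w"
  by (simp_all add: bounded_linear_Re bounded_linear_Im abs_Re_le_cmod abs_Im_le_cmod)

text \<open>The boundary term disappears because the kernel is \<open>0\<close> at
  \<open>\<infinity>\<close>; the sign is the one in front of the Stieltjes integral.\<close>

lemma laplace_primitive:
  assumes F: "is_primitive f F" and z: "Re z > 0"
  shows "laplace f z = - Complex (LBINT t=0..\<infinity>. F (ereal t) * Re (- z * exp (- z * of_real t)))
      (LBINT t=0..\<infinity>. F (ereal t) * Im (- z * exp (- z * of_real t)))"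
proof -
  have c: "continuous_on {0..\<infinity>} F" using F by (simp add: is_primitive_def primitives_def)
  show ?thesis
    unfolding laplace_def AC_integral_complex_def AC_integral_def primitive_eq[OF F]
      laplace_weight_RS[OF c z Re_Im_weight(1,2)] laplace_weight_RS[OF c z Re_Im_weight(3,4)]
    by (rule complex_eqI) (simp_all add: laplace_kernel_def)
qed

section \<open>Decay in the cone\<close>

lemma laplace_small_o:
  assumes f: "f \<in> A_C" and \<alpha>: "0 \<le> \<alpha>" "\<alpha> < pi / 2"
  shows "laplace f \<in> o[inf at_infinity (principal {z. \<bar>Arg z\<bar> \<le> \<alpha>})](\<lambda>_. 1)"
proof (rule landau_o.smallI)
  fix e :: real assume "e > 0"
  obtain F where F: "is_primitive f F" using f by (auto simp: A_C_def)
  have cF: "continuous_on {0..\<infinity>} F" "F 0 = 0" using F by (auto simp: is_primitive_def primitives_def)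
  have cos: "cos \<alpha> > 0" using \<alpha> by (intro cos_gt_zero_pi) auto
  \<comment> \<open>The real and imaginary parts will each be at most
    \<open>1 / cos \<alpha> * (2 * c)\<close>, which this choice makes \<open>e / 2\<close>.\<close>
  define c where "c = e * cos \<alpha> / 4"
  have c: "c > 0" using \<open>e > 0\<close> cos by (simp add: c_def)
  obtain M where M: "M > 0" "\<And>t. 0 \<le> t \<Longrightarrow> \<bar>F t\<bar> \<le> M" using bounded_on_ereal_half_line[OF cF(1)] by blast
  obtain \<delta> where \<delta>: "\<delta> > 0" "\<And>t. 0 \<le> t \<Longrightarrow> t < \<delta> \<Longrightarrow> \<bar>F (ereal t)\<bar> < c"
  proof -
    have "\<exists>d>0. \<forall>t\<in>{0..}. dist t 0 < d \<longrightarrow> dist (F (ereal t)) (F (ereal 0)) < c"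
      using bspec[OF continuous_on_ereal_half_line[OF cF(1), unfolded continuous_on_iff], of 0] c by simp
    then show thesis using that cF(2) by (auto simp: dist_real_def zero_ereal_def)
  qed
  \<comment> \<open>From \<open>t = \<delta>\<close> on, the linear term \<open>C * t\<close> alone
    exceeds the global bound \<open>M\<close>.\<close>
  define C where "C = M / \<delta>"
  have C: "C > 0" using M \<delta> by (simp add: C_def)
  have F_le: "\<bar>F (ereal t)\<bar> \<le> c + C * t" if "0 \<le> t" for t
  proof (cases "t < \<delta>")
    case True
    then show ?thesis using \<delta>(2)[OF that] C that by (simp add: less_imp_le add_increasing2)
  next
    case False
    then have "M \<le> C * t" using M(1) \<delta>(1) by (simp add: C_def field_simps)
    then show ?thesis using M(2)[of "ereal t"] that c by simp
  qed
  \<comment> \<open>Since \<open>Re z \<ge> norm z * cos \<alpha>\<close> in the cone, this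
    threshold gives \<open>Re z \<ge> C / c\<close>, that is,
    \<open>C / Re z \<le> c\<close>.\<close>
  have "norm (laplace f z) \<le> e" if z: "norm z \<ge> C / (c * cos \<alpha>)" "\<bar>Arg z\<bar> \<le> \<alpha>" for z
  proof -
    have "norm z > 0" using z(1) C c cos by (smt (verit) divide_pos_pos mult_pos_pos)
    have "cos (Arg z) \<ge> cos \<alpha>"
      using cos_monotone_0_pi_le[of "\<bar>Arg z\<bar>" \<alpha>] z(2) \<alpha> by simp
    then have r: "Re z \<ge> norm z * cos \<alpha>"
      using \<open>norm z > 0\<close> by (metis Re_rcis mult_left_mono norm_ge_zero rcis_cmod_Arg)
    then have rpos: "Re z > 0" using \<open>norm z > 0\<close> cos by (smt (verit) mult_pos_pos)
    have "C / c \<le> norm z * cos \<alpha>" using z(1) c cos by (simp add: field_simps)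
    then have "C / c \<le> Re z" using r by simp
    then have small: "C / Re z \<le> c" using c rpos by (simp add: field_simps)
    have ratio: "norm z / Re z \<le> 1 / cos \<alpha>" using r rpos cos by (simp add: field_simps)
    have "norm z / Re z * (c + C / Re z) \<le> 1 / cos \<alpha> * (2 * c)"
      using ratio small c C rpos cos by (intro mult_mono) auto
    also have "\<dots> = e / 2" using cos by (simp add: c_def)
    finally have half: "norm z / Re z * (c + C / Re z) \<le> e / 2" .
    note b = laplace_weight_bound[OF cF(1) rpos _ _ less_imp_le[OF c] less_imp_le[OF C] F_le]
    have "norm (laplace f z) \<le> \<bar>Re (laplace f z)\<bar> + \<bar>Im (laplace f z)\<bar>" by (rule cmod_le)
    also have "\<dots> \<le> e / 2 + e / 2"
      unfolding laplace_primitive[OF F rpos] uminus_complex.sel complex.sel abs_minus_cancel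
      by (intro add_mono order_trans[OF _ half] b Re_Im_weight)
    finally show ?thesis by simp
  qed
  then show "eventually (\<lambda>z. norm (laplace f z) \<le> e * norm (1::complex)) (inf at_infinity (principal {z. \<bar>Arg z\<bar> \<le> \<alpha>}))"
    unfolding eventually_inf_principal eventually_at_infinity by auto
qed

section \<open>Sharpness in \<open>L^1\<close>\<close>

text \<open>On the real axis the weight is real and the transform is the integral of
  \<open>F t * x * exp (- x * t)\<close>. Dropping \<open>[0,a]\<close> and replacing
  \<open>F\<close> by \<open>v\<close> beyond \<open>a\<close> leaves
  \<open>v * exp (- x * a)\<close>.\<close>

lemma laplace_monotone_primitive_ge:
  assumes F: "is_primitive f F" and x: "x > 0"
    and pos: "\<And>t. 0 \<le> t \<Longrightarrow> 0 \<le> F (ereal t)"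
    and ge: "\<And>t. a \<le> t \<Longrightarrow> v \<le> F (ereal t)" and a: "a \<ge> 0" and v: "v \<ge> 0"
  shows "Im (laplace f (of_real x)) = 0" "v * exp (- x * a) \<le> Re (laplace f (of_real x))"
proof -
  define z where "z = complex_of_real x"
  have z: "Re z > 0" "Im z = 0" "Re z = x" using x by (auto simp: z_def)
  have cF: "continuous_on {0..\<infinity>} F" using F by (simp add: is_primitive_def primitives_def)
  have ex: "- z * exp (- z * of_real t) = complex_of_real (- x * exp (- x * t))" for t
    by (simp add: z_def flip: exp_of_real)
  have k: "Re (- z * exp (- z * of_real t)) = - (x * exp (- x * t))" "Im (- z * exp (- z * of_real t)) = 0" for t
    unfolding ex by simp_all
  show "Im (laplace f (of_real x)) = 0"
    using laplace_primitive[OF F z(1)] unfolding k by (simp add: z_def)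
  have int: "set_integrable lborel (einterval 0 \<infinity>) (\<lambda>t. F (ereal t) * (x * exp (- x * t)))"
    using laplace_weight_integrable[OF cF z(1) Re_Im_weight(1,2)] unfolding k
    by (simp add: set_integrable_def)
  have "Re (laplace f (of_real x)) = (LBINT t=0..\<infinity>. F (ereal t) * (x * exp (- x * t)))"
    using laplace_primitive[OF F z(1)] unfolding k
    by (simp add: z_def interval_lebesgue_integral_uminus)
  also have "\<dots> = (LBINT t=0..ereal a. F (ereal t) * (x * exp (- x * t))) + (LBINT t=ereal a..\<infinity>. F (ereal t) * (x * exp (- x * t)))"
    by (rule interval_integral_sum[symmetric])
      (use a int in \<open>simp add: interval_lebesgue_integrable_def min_absorb1 max_absorb2\<close>)
  also have "\<dots> \<ge> v * exp (- x * a)"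
  proof -
    have "(LBINT t=0..ereal a. F (ereal t) * (x * exp (- x * t))) \<ge> 0"
      using a x pos unfolding interval_lebesgue_integral_def set_lebesgue_integral_def
      by (auto intro!: Bochner_Integration.integral_nonneg simp: indicator_def einterval_def)
    moreover have "(LBINT t=ereal a..\<infinity>. F (ereal t) * (x * exp (- x * t))) \<ge> (LBINT t=ereal a..\<infinity>. (v + 0 * t) * x * exp (- x * t))"
    proof -
      have "(LBINT t:einterval (ereal a) \<infinity>. (v + 0 * t) * x * exp (- x * t)) \<le> (LBINT t:einterval (ereal a) \<infinity>. F (ereal t) * (x * exp (- x * t)))"
      proof (rule set_integral_mono)
        show "set_integrable lborel (einterval (ereal a) \<infinity>) (\<lambda>t. (v + 0 * t) * x * exp (- x * t))"
          using affine_exp_integral(1)[of v 0 x a] v x a by simp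
        show "set_integrable lborel (einterval (ereal a) \<infinity>) (\<lambda>t. F (ereal t) * (x * exp (- x * t)))"
          using a by (intro set_integrable_einterval_subset[OF int]) auto
      qed (use ge x in \<open>auto simp: einterval_def mult.assoc intro!: mult_right_mono\<close>)
      then show ?thesis by (simp add: interval_lebesgue_integral_def)
    qed
    moreover have "(LBINT t=ereal a..\<infinity>. (v + 0 * t) * x * exp (- x * t)) = v * exp (- x * a)"
      using affine_exp_integral(2)[of v 0 x a] v x a by simp
    ultimately show ?thesis by linarith
  qed
  finally show "v * exp (- x * a) \<le> Re (laplace f (of_real x))" .
qed

text \<open>The primitive is \<open>exp 1\<close> times the smooth majorant. Cutting at
  \<open>a = 1 / x\<close> costs a factor \<open>exp (- 1)\<close>, which the constant
  \<open>exp 1\<close> compensates.\<close>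

lemma laplace_sharp:
  fixes A :: "real \<Rightarrow> real"
  assumes A: "\<And>x. x > 0 \<Longrightarrow> 0 < A x \<and> A x < 1" and lim: "(A \<longlongrightarrow> 0) at_top"
  obtains h where "h absolutely_integrable_on {0<..}" "regular_dist h \<in> A_C"
    "\<And>x. x > 0 \<Longrightarrow> Im (laplace (regular_dist h) (of_real x)) = 0 \<and> A x \<le> Re (laplace (regular_dist h) (of_real x))"
proof -
  obtain G k where G: "modulus G" "\<And>t. isCont G t"
    "\<And>t. t > 0 \<Longrightarrow> (G has_real_derivative k t) (at t)" "continuous_on {0<..} k"
    "\<And>t. t > 0 \<Longrightarrow> k t \<ge> 0" "\<And>x. x > 0 \<Longrightarrow> A x \<le> G (1 / x)"
    by (rule smooth_modulus_majorant[OF A lim]) (auto intro: that)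
  have G': "mono G" "\<And>t. t \<le> 0 \<Longrightarrow> G t = 0" "\<And>t. t \<ge> 1 \<Longrightarrow> G t = 1" using G(1) by (auto simp: modulus_def)
  define h where "h = (\<lambda>t. exp 1 * k t)"
  \<comment> \<open>Truncation at \<open>1\<close> handles \<open>t = \<infinity>\<close>, where
    \<open>real_of_ereal\<close> would return \<open>0\<close> instead of a large number. No other
    value changes, as \<open>G\<close> is constant from \<open>1\<close> on.\<close>
  define F where "F = (\<lambda>t\<in>{0..\<infinity>}. exp 1 * G (real_of_ereal (min t 1)))"
  have F_eq: "F (ereal t) = exp 1 * G t" if "0 \<le> t" for t
    using that G'(3)[of 1] G'(3)[of t] by (cases "t \<le> 1") (auto simp: F_def min_def one_ereal_def)
  have prim: "is_primitive (regular_dist h) F"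
    unfolding is_primitive_def primitives_def
  proof (intro conjI CollectI)
    show "F \<in> extensional {0..\<infinity>}" by (simp add: F_def)
    have "continuous_on {0..\<infinity>} (\<lambda>t::ereal. real_of_ereal (min t 1))"
    proof (rule continuous_on_compose2[OF continuous_on_real])
      show "continuous_on {0..\<infinity>} (\<lambda>t::ereal. min t 1)" by (intro continuous_intros)
    qed (auto simp: min_def one_ereal_def split: if_splits)
    then have "continuous_on {0..\<infinity>} (\<lambda>t. exp 1 * G (real_of_ereal (min t 1)))"
      using G(2) by (intro continuous_on_mult continuous_on_const continuous_on_compose2[OF continuous_at_imp_continuous_on, of UNIV G]) auto
    then show "continuous_on {0..\<infinity>} F" by (rule continuous_on_eq) (simp add: F_def)
    show "F 0 = 0" using F_eq[of 0] G'(2)[of 0] by (simp add: zero_ereal_def)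
    show "regular_dist h = dist_deriv (regular_dist (\<lambda>t. F (ereal t)))"
    proof (rule regular_dist_deriv)
      fix t :: real assume "t > 0"
      then have "((\<lambda>t. exp 1 * G t) has_real_derivative h t) (at t)"
        unfolding h_def by (intro DERIV_cmult G(3))
      then show "((\<lambda>t. F (ereal t)) has_real_derivative h t) (at t)"
        by (rule has_field_derivative_transform_within_open[of _ _ _ "{0<..}"]) (use \<open>t > 0\<close> F_eq in auto)
    qed (use G(4) in \<open>auto simp: h_def intro!: continuous_intros\<close>)
  qed
  \<comment> \<open>A nonnegative derivative is integrable as soon as its antiderivative has finite
    limits at both ends, here \<open>G 0\<close> and \<open>1\<close>.\<close>
  have "set_integrable lborel (einterval 0 \<infinity>) k"
  proof (rule interval_integral_FTC_nonneg)
    show "((G \<circ> real_of_ereal) \<longlongrightarrow> G 0) (at_right 0)"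
      using G(2)[of 0] by (auto simp: zero_ereal_def ereal_tendsto_simps1 isCont_def intro: filterlim_mono at_le)
    have "eventually (\<lambda>t. G t = 1) at_top" using eventually_ge_at_top[of 1] by eventually_elim (rule G'(3))
    then show "((G \<circ> real_of_ereal) \<longlongrightarrow> 1) (at_left \<infinity>)"
      by (simp add: ereal_tendsto_simps1 tendsto_eventually)
    show "isCont k t" if "0 < ereal t" for t using G(4) that by (simp add: continuous_on_eq_continuous_at)
  qed (use G(3,5) in auto)
  then have "integrable lborel (\<lambda>t. indicator {0<..} t *\<^sub>R k t)"
    by (simp add: set_integrable_def zero_ereal_def)
  \<comment> \<open>Passes from Borel measure to its completion, which underlies absolute
    integrability.\<close>
  then have "k absolutely_integrable_on {0<..}"
    unfolding set_integrable_def by (subst integrable_completion) auto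
  then have h: "h absolutely_integrable_on {0<..}" by (simp add: h_def)
  show thesis
  proof (rule that[OF h])
    show "regular_dist h \<in> A_C" using regular_dist_in_distributions[OF h] prim by (auto simp: A_C_def)
    fix x :: real assume x: "x > 0"
    have pos: "0 \<le> G t" for t
      using monoD[OF G'(1), of 0 t] G'(2)[of 0] G'(2)[of t] by (cases "t \<le> 0") auto
    have "0 \<le> F (ereal t)" if "0 \<le> t" for t using that pos by (simp add: F_eq)
    moreover have "exp 1 * G (1 / x) \<le> F (ereal t)" if "1 / x \<le> t" for t
    proof -
      have "0 \<le> t" using that x by (meson divide_nonneg_pos order_trans zero_le_one)
      then show ?thesis using monoD[OF G'(1) that] by (simp add: F_eq)
    qed
    ultimately have "Im (laplace (regular_dist h) (of_real x)) = 0"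
      "exp 1 * G (1 / x) * exp (- x * (1 / x)) \<le> Re (laplace (regular_dist h) (of_real x))"
      using laplace_monotone_primitive_ge[OF prim x, of "1 / x" "exp 1 * G (1 / x)"] x pos by auto
    moreover have "exp 1 * G (1 / x) * exp (- x * (1 / x)) = G (1 / x)"
      using x by (simp add: exp_minus field_simps)
    ultimately show "Im (laplace (regular_dist h) (of_real x)) = 0 \<and> A x \<le> Re (laplace (regular_dist h) (of_real x))"
      using G(6)[OF x] by (metis order_trans)
  qed
qed

text \<open>The filter expresses \<open>z\<close> tending to infinity within the cone. An
  \<open>L^1\<close> function enters through its regular distribution, and a lower bound for the
  complex value of the transform means zero imaginary part together with a bound on the real
  part.\<close>

theorem mainTheorem13:
  "(\<forall>f\<in>A_C. \<forall>\<alpha>::real. 0 \<le> \<alpha> \<and> \<alpha> < pi / 2 \<longrightarrow>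
      laplace f \<in> o[inf at_infinity (principal {z. \<bar>Arg z\<bar> \<le> \<alpha>})](\<lambda>_. 1)) \<and>
   (\<forall>A::real \<Rightarrow> real. (\<forall>x>0. 0 < A x \<and> A x < 1) \<and> (A \<longlongrightarrow> 0) at_top \<longrightarrow>
      (\<exists>h::real \<Rightarrow> real. h absolutely_integrable_on {0<..} \<and> regular_dist h \<in> A_C \<and>
        (\<forall>x\<ge>2. Im (laplace (regular_dist h) (of_real x)) = 0 \<and>
               A x \<le> Re (laplace (regular_dist h) (of_real x)))))"
proof (intro conjI allI ballI impI)
  fix f \<alpha> assume "f \<in> A_C" "0 \<le> \<alpha> \<and> \<alpha> < pi / 2"
  then show "laplace f \<in> o[inf at_infinity (principal {z. \<bar>Arg z\<bar> \<le> \<alpha>})](\<lambda>_. 1)"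
    by (intro laplace_small_o) auto
next
  fix A :: "real \<Rightarrow> real"
  assume "(\<forall>x>0. 0 < A x \<and> A x < 1) \<and> (A \<longlongrightarrow> 0) at_top"
  then obtain h where "h absolutely_integrable_on {0<..}" "regular_dist h \<in> A_C"
    "\<And>x. x > 0 \<Longrightarrow> Im (laplace (regular_dist h) (of_real x)) = 0 \<and> A x \<le> Re (laplace (regular_dist h) (of_real x))"
    using laplace_sharp[of A] by blast
  then show "\<exists>h. h absolutely_integrable_on {0<..} \<and> regular_dist h \<in> A_C \<and>
        (\<forall>x\<ge>2. Im (laplace (regular_dist h) (of_real x)) = 0 \<and>
               A x \<le> Re (laplace (regular_dist h) (of_real x)))"
    by (intro exI[of _ h]) auto
qed

end
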